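(* Consider a partial differential equation of the form $$z_t-\lambda z_{2t}=A(z,z_1,z_2)\,z_3+B(z,z_1,z_2),\qquad \lambda\in\mathbb{R},\ A^2+B^2\neq 0. \qquad (E)$$ Then (E) describes pseudospherical surfaces ($\delta=1$) or spherical surfaces ($\delta=-1$), with corresponding functions $f_{ij}=f_{ij}(z,z_1,\dots,z_k)$ such that $f_{11}=\eta$ is constant, $f_{21}$ and $f_{31}$ are linear non-homogeneous functions of $z$ and $z_2$ with constant coefficients, and $(f_{31,z})^2-\delta (f_{21,z})^2=0$, if and only if (up to linear coordinate transformations $x\mapsto ax,\ t\mapsto bt,\ z\mapsto cz+c_0$, $abc\neq0$) it can be written in one of the following two forms (with upper and lower signs chosen consistently in each form): **(I)** $$z_t-\lambda z_{2t}=D_x\psi+a\,\psi+b\,(z-\lambda z_2)$$ with $\delta=1$ and associated 1-forms $$\omega_1=\mp(a\,dx-b\,dt),\qquad \omega_2=(z-\lambda z_2)\,dx+\psi\,dt,\qquad \omega_3=\pm\,\omega_2,$$ where $\psi=\psi(z,z_1,z_2)$ is a real differentiable function and $a,b\in\{0,1\}$, with $a^2+b^2\neq0$ and $a\psi+b(z-\lambda z_2)\neq0$; **(II)** $$z_t-\lambda z_{2t}=\mp D_x^3h-D_x\big((z-\lambda z_2)h\big)-(z-\lambda z_2)\,D_x h$$ with $\delta=1$ and associated 1-forms $$\omega_1=\eta\,dx+(\mp D_xh-\eta h)\,dt,$$ $$\omega_2=\frac1\alpha\Big[\Big(z-\lambda z_2\pm\frac{\eta^2}{2}\mp\frac{\alpha^2}{2}\Big)dx+\Big(\mp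 D_x^2h-\eta D_xh-\Big(z-\lambda z_2\pm\frac{\eta^2}{2}\mp\frac{\alpha^2}{2}\Big)h\Big)dt\Big],$$ $$\omega_3=\pm\,\omega_2+\alpha\,(dx-h\,dt),$$ where $h=h(z)$ is a real differentiable function with $h'\neq0$ and $\eta,\alpha\in\mathbb{R}$, $\alpha\neq0$.
   Context: Notation: $z=z(x,t)$ is a real function; $z_i=\partial_x^i z$ ($z_0=z$), $z_t=\partial_t z$, $z_{2t}=\partial_t z_2$. $D_x$, $D_t$ are the total derivatives with respect to $x$ and $t$; on a function $F(z,z_1,\dots,z_m)$, $D_xF=\sum_i z_{i+1}F_{,z_i}$. A subscript $,z$ or $,z_i$ denotes a partial derivative. All functions are differentiable as many times as needed. Inequalities "$\neq0$" for functions are understood generically (on a nonempty open set). Definition. Let $\delta\in\{1,-1\}$. A differential equation $\mathcal{E}$ for $z(x,t)$ describes pseudospherical surfaces (pss) if $\delta=1$, or spherical surfaces (ss) if $\delta=-1$, with corresponding functions $f_{ij}$ ($1\le i\le3$, $1\le j\le2$), if $\mathcal{E}$ is equivalent to (i.e. $z$ solves $\mathcal{E}$ if and only if the following hold) the structure equations $$d\omega_1=\omega_3\wedge\omega_2,\quad d\omega_2=\omega_1\wedge\omega_3,\quad d\omega_3=\delta\,\omega_1\wedge\omega_2$$ of a surface with Gaussian curvature $K=-\delta$, where $\omega_i=f_{i1}dx+f_{i2}dt$ (the associated 1-forms), and $\omega_1\wedge\omega_2\neq0$, i.e. $f_{11}f_{22}-f_{12}f_{21}\neq0$. Here $f_{ij}$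 are functions of $z$ and finitely many of its $x$-derivatives. Convention on transformations. The class of equations considered and the conditions on the $f_{i1}$ are invariant under linear coordinate transformations $x\mapsto ax$, $t\mapsto bt$, $z\mapsto cz+c_0$ with $a,b,c,c_0\in\mathbb{R}$, $abc\neq0$ (such a transformation may change the value of the constant $\lambda$, and acts on $A$, $B$ and the 1-forms accordingly). The classification is given only up to such transformations. (The constants $a,b$ in form (I) are unrelated to those of the transformations.) *)

theory Defs
  imports "HOL-Analysis.Analysis"
begin

section \<open>Functions of z and its x-derivatives\<close>

text \<open>
  A jet \<open>u\<close> lists the values \<open>u i\<close> of \<open>z_i\<close> (the \<open>i\<close>-th x-derivative of \<open>z\<close>) at a point; a second
  sequence \<open>v\<close> lists the values \<open>v i\<close> of \<open>z_{it}\<close> (the t-derivative of \<open>z_i\<close>). Since every jet of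
  finite order is the jet of some smooth \<open>z(x,t)\<close>, an equation for \<open>z\<close> is a relation between \<open>u\<close>
  and \<open>v\<close>.

  All functions are considered for \<open>z_i\<close> in \<open>I i\<close>, where the \<open>I i\<close> are nonempty open intervals
  (\<open>I i = UNIV\<close> for globally defined functions).
\<close>

type_synonym jet = "nat \<Rightarrow> real"
type_synonym jetfun = "jet \<Rightarrow> real"

definition jet_domain :: "(nat \<Rightarrow> real set) \<Rightarrow> bool" where
  "jet_domain I \<longleftrightarrow> (\<forall>i. open (I i) \<and> is_interval (I i) \<and> I i \<noteq> {})"

definition jets :: "(nat \<Rightarrow> real set) \<Rightarrow> jet set" where
  "jets I = {u. \<forall>i. u i \<in> I i}"

definition pd :: "nat \<Rightarrow> jetfun \<Rightarrow> jetfun" where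
  "pd i F u = deriv (\<lambda>s. F (u(i := s))) (u i)"

text \<open>
  \<open>jet_smooth I m F\<close>: on \<open>jets I\<close>, \<open>F\<close> is a function of \<open>z, z_1, ..., z_m\<close> only, and it is smooth,
  i.e. all iterated partial derivatives exist and are continuous. Continuity refers to the product
  topology on \<open>nat \<Rightarrow> real\<close>, which for functions of \<open>z, ..., z_m\<close> is continuity in \<open>m + 1\<close> real
  variables.
\<close>

definition jet_smooth :: "(nat \<Rightarrow> real set) \<Rightarrow> nat \<Rightarrow> jetfun \<Rightarrow> bool" where
  "jet_smooth I m F \<longleftrightarrow>
     (\<forall>u\<in>jets I. \<forall>u'\<in>jets I. (\<forall>i\<le>m. u i = u' i) \<longrightarrow> F u = F u') \<and>
     (\<forall>ns. continuous_on (jets I) (foldr pd ns F) \<and>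
        (\<forall>u\<in>jets I. \<forall>i. (\<lambda>s. foldr pd ns F (u(i := s))) differentiable (at (u i))))"

text \<open>The inequality \<open>F \<noteq> 0\<close> for functions is generic: it holds on some nonempty open set.\<close>

definition generically_nonzero :: "(nat \<Rightarrow> real set) \<Rightarrow> jetfun \<Rightarrow> bool" where
  "generically_nonzero I F \<longleftrightarrow>
     (\<exists>J. jet_domain J \<and> (\<forall>i. J i \<subseteq> I i) \<and> (\<forall>u\<in>jets J. F u \<noteq> 0))"

text \<open>
  Total derivatives. The series are finite sums, as \<open>pd i F = 0\<close> on \<open>jets I\<close> for \<open>i > m\<close> when \<open>F\<close>
  is a function of \<open>z, ..., z_m\<close>.
\<close>

definition Dx :: "jetfun \<Rightarrow> jetfun" where
  "Dx F u = (\<Sum>i. u (Suc i) * pd i F u)"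

definition Dt :: "jetfun \<Rightarrow> jet \<Rightarrow> jet \<Rightarrow> real" where
  "Dt F u v = (\<Sum>i. v i * pd i F u)"


section \<open>Equations describing pseudospherical or spherical surfaces\<close>

text \<open>
  The pair \<open>(p, q)\<close> stands for the 1-form \<open>p dx + q dt\<close>; 2-forms are represented by their
  coefficient with respect to \<open>dx \<and> dt\<close>.
\<close>

type_synonym form = "jetfun \<times> jetfun"

definition wedge :: "form \<Rightarrow> form \<Rightarrow> jetfun" where
  "wedge \<omega> \<theta> u = fst \<omega> u * snd \<theta> u - snd \<omega> u * fst \<theta> u"

definition ext_d :: "form \<Rightarrow> jet \<Rightarrow> jet \<Rightarrow> real" where
  "ext_d \<omega> u v = Dx (snd \<omega>) u - Dt (fst \<omega>) u v"

definition structure_equations :: "real \<Rightarrow> form \<Rightarrow> form \<Rightarrow> form \<Rightarrow> jet \<Rightarrow> jet \<Rightarrow> bool" where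
  "structure_equations \<delta> \<omega>1 \<omega>2 \<omega>3 u v \<longleftrightarrow>
     ext_d \<omega>1 u v = wedge \<omega>3 \<omega>2 u \<and>
     ext_d \<omega>2 u v = wedge \<omega>1 \<omega>3 u \<and>
     ext_d \<omega>3 u v = \<delta> * wedge \<omega>1 \<omega>2 u"

definition assoc_form :: "(nat \<Rightarrow> nat \<Rightarrow> jetfun) \<Rightarrow> nat \<Rightarrow> form" where
  "assoc_form f i = (f i 1, f i 2)"

text \<open>
  The equation \<open>E\<close> describes pseudospherical (\<open>\<delta> = 1\<close>) or spherical (\<open>\<delta> = -1\<close>) surfaces with
  corresponding functions \<open>f i j\<close>, \<open>i = 1, 2, 3\<close>, \<open>j = 1, 2\<close>. Equivalence of \<open>E\<close> with the structure
  equations is equivalence as equations on jets: at every point, \<open>z\<close> satisfies \<open>E\<close> if and only if it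
  satisfies the structure equations.
\<close>

definition describes ::
  "(nat \<Rightarrow> real set) \<Rightarrow> real \<Rightarrow> (jet \<Rightarrow> jet \<Rightarrow> bool) \<Rightarrow> (nat \<Rightarrow> nat \<Rightarrow> jetfun) \<Rightarrow> bool" where
  "describes I \<delta> E f \<longleftrightarrow>
     (\<exists>k. \<forall>i\<in>{1..3}. \<forall>j\<in>{1..2}. jet_smooth I k (f i j)) \<and>
     (\<forall>u\<in>jets I. \<forall>v. E u v \<longleftrightarrow>
        structure_equations \<delta> (assoc_form f 1) (assoc_form f 2) (assoc_form f 3) u v) \<and>
     generically_nonzero I (wedge (assoc_form f 1) (assoc_form f 2))"

definition constant_on_jets :: "(nat \<Rightarrow> real set) \<Rightarrow> jetfun \<Rightarrow> bool" where
  "constant_on_jets I F \<longleftrightarrow> (\<exists>\<eta>. \<forall>u\<in>jets I. F u = \<eta>)"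

definition affine_in_z_z2 :: "(nat \<Rightarrow> real set) \<Rightarrow> jetfun \<Rightarrow> bool" where
  "affine_in_z_z2 I F \<longleftrightarrow> (\<exists>p q r. \<forall>u\<in>jets I. F u = p * u 0 + q * u 2 + r)"

definition admissible :: "(nat \<Rightarrow> real set) \<Rightarrow> real \<Rightarrow> (nat \<Rightarrow> nat \<Rightarrow> jetfun) \<Rightarrow> bool" where
  "admissible I \<delta> f \<longleftrightarrow>
     constant_on_jets I (f 1 1) \<and> affine_in_z_z2 I (f 2 1) \<and> affine_in_z_z2 I (f 3 1) \<and>
     (\<forall>u\<in>jets I. (pd 0 (f 3 1) u)\<^sup>2 - \<delta> * (pd 0 (f 2 1) u)\<^sup>2 = 0)"

text \<open>The equation \<open>z_t - lam z_{2t} = A z_3 + B\<close>.\<close>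

definition third_order_eq :: "real \<Rightarrow> jetfun \<Rightarrow> jetfun \<Rightarrow> jet \<Rightarrow> jet \<Rightarrow> bool" where
  "third_order_eq lam A B u v \<longleftrightarrow> v 0 - lam * v 2 = A u * u 3 + B u"


section \<open>Linear coordinate transformations\<close>

text \<open>
  New coordinates \<open>x' = a x\<close>, \<open>t' = b t\<close> and \<open>z' = c z + c0\<close> give \<open>z'_i = c z_i / a^i\<close> for
  \<open>i > 0\<close>; \<open>old_coord a c c0 i s\<close> is the value of \<open>z_i\<close> when \<open>z'_i = s\<close>.
\<close>

definition old_coord :: "real \<Rightarrow> real \<Rightarrow> real \<Rightarrow> nat \<Rightarrow> real \<Rightarrow> real" where
  "old_coord a c c0 i s = a ^ i / c * (if i = 0 then s - c0 else s)"

definition tr_domain ::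
  "real \<Rightarrow> real \<Rightarrow> real \<Rightarrow> (nat \<Rightarrow> real set) \<Rightarrow> nat \<Rightarrow> real set" where
  "tr_domain a c c0 I i = {s. old_coord a c c0 i s \<in> I i}"

definition tr_fun :: "real \<Rightarrow> real \<Rightarrow> real \<Rightarrow> jetfun \<Rightarrow> jetfun" where
  "tr_fun a c c0 F u = F (\<lambda>i. old_coord a c c0 i (u i))"

text \<open>
  As \<open>z'_{t'} - a^2 lam z'_{2t'} = (c / b) (z_t - lam z_{2t})\<close> and \<open>z_3 = (a^3 / c) z'_3\<close>, the equation
  in the new coordinates has the following data.
\<close>

definition tr_lam :: "real \<Rightarrow> real \<Rightarrow> real" where
  "tr_lam a lam = a\<^sup>2 * lam"

definition tr_A :: "real \<Rightarrow> real \<Rightarrow> real \<Rightarrow> real \<Rightarrow> jetfun \<Rightarrow> jetfun" where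
  "tr_A a b c c0 A u = a ^ 3 / b * tr_fun a c c0 A u"

definition tr_B :: "real \<Rightarrow> real \<Rightarrow> real \<Rightarrow> real \<Rightarrow> jetfun \<Rightarrow> jetfun" where
  "tr_B a b c c0 B u = c / b * tr_fun a c c0 B u"

text \<open>\<open>f_{i1} dx + f_{i2} dt = (f_{i1} / a) dx' + (f_{i2} / b) dt'\<close>\<close>

definition tr_forms ::
  "real \<Rightarrow> real \<Rightarrow> real \<Rightarrow> real \<Rightarrow> (nat \<Rightarrow> nat \<Rightarrow> jetfun) \<Rightarrow> nat \<Rightarrow> nat \<Rightarrow> jetfun" where
  "tr_forms a b c c0 f i j u = tr_fun a c c0 (f i j) u / (if j = 1 then a else b)"


section \<open>The two normal forms\<close>

text \<open>
  Both predicates say that the equation with data \<open>lam, A, B\<close> is of the respective form and that the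
  \<open>g i j\<close> are the coefficients of the associated 1-forms. The sign \<open>\<epsilon>\<close> is \<open>1\<close> for the upper and
  \<open>-1\<close> for the lower signs.
\<close>

definition form_I ::
  "(nat \<Rightarrow> real set) \<Rightarrow> real \<Rightarrow> jetfun \<Rightarrow> jetfun \<Rightarrow> (nat \<Rightarrow> nat \<Rightarrow> jetfun) \<Rightarrow> bool" where
  "form_I I lam A B g \<longleftrightarrow>
     (\<exists>\<epsilon>\<in>{1, -1}. \<exists>a\<in>{0, 1}. \<exists>b\<in>{0, 1}. \<exists>\<psi>.
        let w = (\<lambda>u. u 0 - lam * u 2) in
        jet_smooth I 2 \<psi> \<and> a\<^sup>2 + b\<^sup>2 \<noteq> 0 \<and>
        generically_nonzero I (\<lambda>u. a * \<psi> u + b * w u) \<and>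
        (\<forall>u\<in>jets I.
           A u * u 3 + B u = Dx \<psi> u + a * \<psi> u + b * w u \<and>
           g 1 1 u = - \<epsilon> * a \<and>
           g 1 2 u = \<epsilon> * b \<and>
           g 2 1 u = w u \<and>
           g 2 2 u = \<psi> u \<and>
           g 3 1 u = \<epsilon> * g 2 1 u \<and>
           g 3 2 u = \<epsilon> * g 2 2 u))"

definition form_II ::
  "(nat \<Rightarrow> real set) \<Rightarrow> real \<Rightarrow> jetfun \<Rightarrow> jetfun \<Rightarrow> (nat \<Rightarrow> nat \<Rightarrow> jetfun) \<Rightarrow> bool" where
  "form_II I lam A B g \<longleftrightarrow>
     (\<exists>\<epsilon>\<in>{1, -1}. \<exists>\<eta> \<alpha>. \<exists>h.
        let w = (\<lambda>u. u 0 - lam * u 2);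
            m = (\<lambda>u. w u + \<epsilon> * \<eta>\<^sup>2 / 2 - \<epsilon> * \<alpha>\<^sup>2 / 2) in
        jet_smooth I 0 h \<and> generically_nonzero I (pd 0 h) \<and> \<alpha> \<noteq> 0 \<and>
        (\<forall>u\<in>jets I.
           A u * u 3 + B u =
             - \<epsilon> * Dx (Dx (Dx h)) u - Dx (\<lambda>u. w u * h u) u - w u * Dx h u \<and>
           g 1 1 u = \<eta> \<and>
           g 1 2 u = - \<epsilon> * Dx h u - \<eta> * h u \<and>
           g 2 1 u = 1 / \<alpha> * m u \<and>
           g 2 2 u = 1 / \<alpha> * (- \<epsilon> * Dx (Dx h) u - \<eta> * Dx h u - m u * h u) \<and>
           g 3 1 u = \<epsilon> * g 2 1 u + \<alpha> \<and>
           g 3 2 u = \<epsilon> * g 2 2 u - \<alpha> * h u))"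

end

theory Submission
  imports Defs
begin

text \<open>
  Comparing the coefficients of \<open>z_t\<close> and \<open>z_{2t}\<close> shows that \<open>f_{21}\<close> and \<open>f_{31}\<close> are affine in
  \<open>w = z - \<lambda> z_2\<close>, and \<open>(f_{31,z})\<^sup>2 = \<delta> (f_{21,z})\<^sup>2\<close> then forces \<open>\<delta> = 1\<close> and
  \<open>f_{31} = \<epsilon> f_{21} + L\<close> with constants \<open>\<epsilon> = \<plusminus>1\<close> and \<open>L\<close>. Put \<open>N = f_{32} - \<epsilon> f_{22}\<close>. The structure
  equations give \<open>D_x N = \<epsilon> (L f_{12} - \<eta> N)\<close> and \<open>D_x f_{12} = L f_{22} - N f_{21}\<close>.

  If \<open>L = 0\<close>, then \<open>N\<close> is constant, since \<open>D_x\<close> raises the order of a nonconstant function; then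
  \<open>D_x f_{12} = - N f_{21}\<close> is possible only for \<open>N = 0\<close> and constant \<open>f_{12}\<close>, which is form (I). If
  \<open>L \<noteq> 0\<close>, then \<open>f_{12}\<close> and \<open>f_{22}\<close> are expressed by \<open>h = - N / L\<close> and its total derivatives; as
  the equation has order three, \<open>h\<close> depends on \<open>z\<close> only, which is form (II).
\<close>

section \<open>Calculus on jets\<close>

text \<open>The functions \<open>f_{i2}\<close> come with some unknown order \<open>k\<close>, so
  every bound on an order is a descent: if \<open>F\<close> is a function of
  \<open>z, ..., z_m\<close> and \<open>D_x F\<close> does not involve \<open>z_{m+1}\<close>, then
  \<open>F\<close> does not involve \<open>z_m\<close>, and at \<open>m = 0\<close> it is constant.
  For \<open>h\<close> in form (II) the available relation expresses only
  \<open>D_x D_x D_x h\<close>, so the descent has to pass through \<open>D_x D_x h\<close> and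
  \<open>D_x h\<close> before it reaches \<open>h\<close>.

  The constant in form (II) has the following origin. Put \<open>m = \<alpha> f_{21}\<close>.
  Eliminating \<open>f_{12}\<close>, \<open>f_{22}\<close> and \<open>f_{32}\<close> from the second
  structure equation leaves the terms
  \<open>- 2 m D_x h + \<epsilon> (\<eta>^2 - \<alpha>^2) D_x h\<close>. A shift of \<open>z\<close>
  can give \<open>m\<close> the additive constant
  \<open>\<epsilon> (\<eta>^2 - \<alpha>^2) / 2\<close>, and the two terms then combine to
  \<open>- 2 w D_x h\<close>.

  In the converse direction the delicate point is
  \<open>\<omega>1 \<and> \<omega>2 \<noteq> 0\<close> for form (II): it is not among the conditions
  of that form and has to be extracted from \<open>h' \<noteq> 0\<close>.\<close>

definition depends_upto :: "(nat \<Rightarrow> real set) \<Rightarrow> nat \<Rightarrow> jetfun \<Rightarrow> bool" where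
  "depends_upto I m F \<longleftrightarrow>
     (\<forall>u\<in>jets I. \<forall>u'\<in>jets I. (\<forall>i\<le>m. u i = u' i) \<longrightarrow> F u = F u')"

text \<open>Smoothness is kept apart from the order, so that lowering the order of a function is a
  statement about \<open>depends_upto\<close> alone.\<close>

definition smooth_on_jets :: "(nat \<Rightarrow> real set) \<Rightarrow> jetfun \<Rightarrow> bool" where
  "smooth_on_jets I F \<longleftrightarrow>
     (\<forall>ns. continuous_on (jets I) (foldr pd ns F) \<and>
        (\<forall>u\<in>jets I. \<forall>i. (\<lambda>s. foldr pd ns F (u(i := s))) differentiable (at (u i))))"

lemma jet_smooth_iff: "jet_smooth I m F \<longleftrightarrow> depends_upto I m F \<and> smooth_on_jets I F"
  by (simp add: jet_smooth_def depends_upto_def smooth_on_jets_def)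

lemma depends_uptoD:
  assumes "depends_upto I m F" "u \<in> jets I" "u' \<in> jets I" "\<And>i. i \<le> m \<Longrightarrow> u i = u' i"
  shows "F u = F u'"
  using assms unfolding depends_upto_def by blast

lemma depends_upto_mono: "depends_upto I m F \<Longrightarrow> m \<le> n \<Longrightarrow> depends_upto I n F"
  unfolding depends_upto_def by (intro ballI impI) (blast intro: le_trans)

lemma depends_upto_cong:
  assumes "\<And>u. u \<in> jets I \<Longrightarrow> F u = G u"
  shows "depends_upto I m F \<longleftrightarrow> depends_upto I m G"
  using assms by (simp add: depends_upto_def)

lemma depends_upto_congI:
  assumes "\<And>u. u \<in> jets I \<Longrightarrow> F u = G u" "depends_upto I m G"
  shows "depends_upto I m F"
  using assms depends_upto_cong by blast

lemma depends_upto_const: "depends_upto I m (\<lambda>_. k)"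
  by (simp add: depends_upto_def)

lemma depends_upto_coord: "j \<le> m \<Longrightarrow> depends_upto I m (\<lambda>u. u j)"
  by (simp add: depends_upto_def)

lemma depends_upto_add:
  "depends_upto I m F \<Longrightarrow> depends_upto I m G \<Longrightarrow> depends_upto I m (\<lambda>u. F u + G u)"
  unfolding depends_upto_def by (intro ballI impI arg_cong2[where f = "(+)"]) blast+

lemma depends_upto_mult:
  "depends_upto I m F \<Longrightarrow> depends_upto I m G \<Longrightarrow> depends_upto I m (\<lambda>u. F u * G u)"
  unfolding depends_upto_def by (intro ballI impI arg_cong2[where f = "(*)"]) blast+

lemma depends_upto_minus: "depends_upto I m F \<Longrightarrow> depends_upto I m (\<lambda>u. - F u)"
  unfolding depends_upto_def by (intro ballI impI arg_cong[where f = uminus]) blast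

lemma depends_upto_diff:
  "depends_upto I m F \<Longrightarrow> depends_upto I m G \<Longrightarrow> depends_upto I m (\<lambda>u. F u - G u)"
  unfolding depends_upto_def by (intro ballI impI arg_cong2[where f = "(-)"]) blast+

lemmas depends_upto_intros = depends_upto_const depends_upto_coord depends_upto_add
  depends_upto_mult depends_upto_minus depends_upto_diff

section \<open>Open domains of jets and locality of partial derivatives\<close>

lemma jets_upd: "u \<in> jets I \<Longrightarrow> s \<in> I i \<Longrightarrow> u(i := s) \<in> jets I"
  by (simp add: jets_def)

lemma jetsD: "u \<in> jets I \<Longrightarrow> u i \<in> I i"
  by (simp add: jets_def)

lemma jets_nonempty: "jet_domain I \<Longrightarrow> jets I \<noteq> {}"
proof -
  assume "jet_domain I"
  then have "(\<lambda>i. SOME x. x \<in> I i) \<in> jets I"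
    by (simp add: jet_domain_def jets_def some_in_eq)
  then show ?thesis by blast
qed

lemma eventually_jets_upd:
  assumes "jet_domain I" "u \<in> jets I"
  shows "\<forall>\<^sub>F s in nhds (u i). u(i := s) \<in> jets I"
proof -
  have "\<forall>\<^sub>F s in nhds (u i). s \<in> I i"
    using assms by (intro eventually_nhds_in_open) (auto simp: jet_domain_def jetsD)
  then show ?thesis
    by eventually_elim (simp add: jets_upd assms)
qed

lemma jet_domain_other:
  assumes "jet_domain I" "x \<in> I i"
  obtains y where "y \<in> I i" "y \<noteq> x"
proof -
  obtain e where e: "e > 0" "ball x e \<subseteq> I i"
    using assms open_contains_ball unfolding jet_domain_def by meson
  then have "x + e / 2 \<in> I i"
    by (auto simp: dist_real_def subset_eq)
  with e show ?thesis
    by (intro that) auto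
qed

lemma pd_cong:
  assumes "jet_domain I" "u \<in> jets I" "\<And>u. u \<in> jets I \<Longrightarrow> F u = G u"
  shows "pd i F u = pd i G u"
  unfolding pd_def
  by (rule deriv_cong_ev)
    (use eventually_mono[OF eventually_jets_upd[OF assms(1,2)]] assms(3) in auto)

lemma partial_differentiable_cong:
  fixes F G :: jetfun
  assumes "jet_domain I" "u \<in> jets I" "\<And>u. u \<in> jets I \<Longrightarrow> F u = G u"
    and "(\<lambda>s. F (u(i := s))) differentiable (at (u i))"
  shows "(\<lambda>s. G (u(i := s))) differentiable (at (u i))"
proof -
  obtain D where D: "((\<lambda>s. F (u(i := s))) has_real_derivative D) (at (u i))"
    using assms(4) real_differentiable_def by auto
  have "((\<lambda>s. G (u(i := s))) has_real_derivative D) (at (u i)) \<longleftrightarrow>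
    ((\<lambda>s. F (u(i := s))) has_real_derivative D) (at (u i))"
    by (rule DERIV_cong_ev)
      (use eventually_mono[OF eventually_jets_upd[OF assms(1,2)]] assms(3) in auto)
  with D show ?thesis
    using real_differentiable_def by blast
qed

text \<open>By induction on \<open>ns\<close>, every iterated partial derivative of \<open>F\<close>
  agrees on \<open>jets I\<close> with a member of \<open>S\<close>. Agreement on
  \<open>jets I\<close> is enough because each \<open>I i\<close> is open, so a partial derivative
  at a point of \<open>jets I\<close> sees only values taken there. Each smoothness proof below thus
  reduces to finding a set of functions that is closed under one partial derivative.\<close>

lemma smooth_on_jets_coinduct:
  assumes I: "jet_domain I" and F: "F \<in> S"
    and cont: "\<And>F. F \<in> S \<Longrightarrow> continuous_on (jets I) F"
    and diff: "\<And>F u i. F \<in> S \<Longrightarrow> u \<in> jets I \<Longrightarrow> (\<lambda>s. F (u(i := s))) differentiable (at (u i))"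
    and pd: "\<And>F i. F \<in> S \<Longrightarrow> \<exists>G\<in>S. \<forall>u\<in>jets I. pd i F u = G u"
  shows "smooth_on_jets I F"
  unfolding smooth_on_jets_def
proof
  fix ns
  have "\<exists>G\<in>S. \<forall>u\<in>jets I. foldr pd ns F u = G u"
  proof (induction ns)
    case Nil
    then show ?case using F by auto
  next
    case (Cons i ns)
    then obtain G where G: "G \<in> S" "\<forall>u\<in>jets I. foldr pd ns F u = G u"
      by blast
    then have "pd i (foldr pd ns F) u = pd i G u" if "u \<in> jets I" for u
      using pd_cong[OF I that] by blast
    with pd[OF G(1), of i] show ?case
      by auto
  qed
  then obtain G where G: "G \<in> S" "\<And>u. u\<in>jets I \<Longrightarrow> G u = foldr pd ns F u"
    by force
  show "continuous_on (jets I) (foldr pd ns F) \<and>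
        (\<forall>u\<in>jets I. \<forall>i. (\<lambda>s. foldr pd ns F (u(i := s))) differentiable (at (u i)))"
  proof (intro conjI ballI allI)
    show "continuous_on (jets I) (foldr pd ns F)"
      using cont[OF G(1)] G(2) by (metis continuous_on_cong)
  next
    fix u i assume "u \<in> jets I"
    then show "(\<lambda>s. foldr pd ns F (u(i := s))) differentiable (at (u i))"
      using partial_differentiable_cong[OF I _ G(2) diff[OF G(1)]] by blast
  qed
qed

lemma smooth_on_jets_continuous: "smooth_on_jets I F \<Longrightarrow> continuous_on (jets I) F"
  unfolding smooth_on_jets_def by (metis foldr_Nil id_apply)

lemma smooth_on_jets_differentiable:
  "smooth_on_jets I F \<Longrightarrow> u \<in> jets I \<Longrightarrow> (\<lambda>s. F (u(i := s))) differentiable (at (u i))"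
  unfolding smooth_on_jets_def by (metis foldr_Nil id_apply)

lemma smooth_on_jets_has_pd:
  assumes "smooth_on_jets I F" "u \<in> jets I"
  shows "((\<lambda>s. F (u(i := s))) has_real_derivative pd i F u) (at (u i))"
  using smooth_on_jets_differentiable[OF assms] unfolding pd_def
  by (simp add: DERIV_deriv_iff_real_differentiable)

lemma pd_eqI: "((\<lambda>s. F (u(i := s))) has_real_derivative D) (at (u i)) \<Longrightarrow> pd i F u = D"
  unfolding pd_def by (rule DERIV_imp_deriv)

lemma smooth_on_jets_pd: 
  assumes "smooth_on_jets I F" shows "smooth_on_jets I (pd i F)"
  unfolding smooth_on_jets_def
proof
  fix ns
  show "continuous_on (jets I) (foldr pd ns (pd i F)) \<and>
      (\<forall>u\<in>jets I. \<forall>j. (\<lambda>s. foldr pd ns (pd i F) (u(j := s))) differentiable (at (u j)))"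
    \<comment> \<open>\<open>foldr\<close> applies the last entry of the list first, so
      \<open>ns @ [i]\<close> differentiates by \<open>z_i\<close> before everything in
      \<open>ns\<close>.\<close>
    using assms[unfolded smooth_on_jets_def, THEN spec, of "ns @ [i]"] by simp
qed

lemma smooth_on_jets_cong:
  assumes I: "jet_domain I" and eq: "\<And>u. u \<in> jets I \<Longrightarrow> F u = G u"
  shows "smooth_on_jets I F \<longleftrightarrow> smooth_on_jets I G"
proof -
  have *: "smooth_on_jets I G"
    if F: "smooth_on_jets I F" and eq: "\<And>u. u \<in> jets I \<Longrightarrow> F u = G u" for F G
  proof (rule smooth_on_jets_coinduct[OF I, of G "{G. \<exists>F. smooth_on_jets I F \<and> (\<forall>u\<in>jets I. F u = G u)}"])
    show "G \<in> {G. \<exists>F. smooth_on_jets I F \<and> (\<forall>u\<in>jets I. F u = G u)}"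
      using F eq by blast
  next
    fix G assume "G \<in> {G. \<exists>F. smooth_on_jets I F \<and> (\<forall>u\<in>jets I. F u = G u)}"
    then obtain F where F: "smooth_on_jets I F" "\<And>u. u\<in>jets I \<Longrightarrow> F u = G u" by blast
    show "continuous_on (jets I) G"
      using smooth_on_jets_continuous[OF F(1)] F(2) by (metis continuous_on_cong)
    show "(\<lambda>s. G (u(i := s))) differentiable (at (u i))" if "u \<in> jets I" for u i
      using partial_differentiable_cong[OF I that F(2) smooth_on_jets_differentiable[OF F(1) that]] .
    show "\<exists>H\<in>{G. \<exists>F. smooth_on_jets I F \<and> (\<forall>u\<in>jets I. F u = G u)}. \<forall>u\<in>jets I. pd i G u = H u" for i
      using smooth_on_jets_pd[OF F(1), of i] pd_cong[OF I _ F(2), where i = i]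
      by (intro bexI[of _ "pd i G"] CollectI exI[of _ "pd i F"]) simp_all
  qed
  show ?thesis
    using * [of F G] * [of G F] eq by metis
qed

section \<open>Closure properties of smooth functions\<close>

lemma smooth_on_jets_const: "jet_domain I \<Longrightarrow> smooth_on_jets I (\<lambda>_. k)"
  by (rule smooth_on_jets_coinduct[where S = "range (\<lambda>k _. k)"])
    (auto simp: pd_def intro!: exI[of _ 0])

lemma pd_coord: "pd i (\<lambda>u. u j) u = (if i = j then 1 else 0)"
  by (rule pd_eqI) (auto intro!: derivative_eq_intros)

lemma pd_const: "pd i (\<lambda>_. k) u = 0"
  by (rule pd_eqI) auto

lemma smooth_on_jets_coord: "jet_domain I \<Longrightarrow> smooth_on_jets I (\<lambda>u. u j)"
proof (rule smooth_on_jets_coinduct[where S = "insert (\<lambda>u. u j) (range (\<lambda>k _. k))"], goal_cases)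
  case (3 F)
  then show ?case
    by (auto intro: continuous_on_subset[OF continuous_on_product_coordinates])
next
  case (4 F u i)
  then show ?case
    by (cases "i = j") auto
next
  case (5 F i)
  then show ?case
    by (auto simp: pd_coord pd_const)
qed auto

text \<open>The products alone are not closed under \<open>pd\<close>, since the product rule
  produces sums. The algebra generated by the smooth functions is closed on \<open>jets I\<close>
  and can serve as the set \<open>S\<close> of \<open>smooth_on_jets_coinduct\<close>.\<close>

inductive_set smooth_algebra :: "(nat \<Rightarrow> real set) \<Rightarrow> jetfun set" for I where
  base: "smooth_on_jets I F \<Longrightarrow> F \<in> smooth_algebra I"
| add: "F \<in> smooth_algebra I \<Longrightarrow> G \<in> smooth_algebra I \<Longrightarrow> (\<lambda>u. F u + G u) \<in> smooth_algebra I"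
| mult: "F \<in> smooth_algebra I \<Longrightarrow> G \<in> smooth_algebra I \<Longrightarrow> (\<lambda>u. F u * G u) \<in> smooth_algebra I"

lemma smooth_algebra_smooth:
  assumes I: "jet_domain I" and "F \<in> smooth_algebra I"
  shows "smooth_on_jets I F"
proof (rule smooth_on_jets_coinduct[OF assms])
  fix F assume F: "F \<in> smooth_algebra I"
  then show "continuous_on (jets I) F"
    by induction (auto intro: smooth_on_jets_continuous continuous_intros)
  show diff: "(\<lambda>s. F (u(i := s))) differentiable (at (u i))" if "u \<in> jets I" for u i
    using F by induction (auto simp del: fun_upd_apply intro: smooth_on_jets_differentiable that)
  show "\<exists>G\<in>smooth_algebra I. \<forall>u\<in>jets I. pd i F u = G u" for i
  proof -
    have "\<exists>G\<in>smooth_algebra I. \<forall>u\<in>jets I. 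
        ((\<lambda>s. F (u(i := s))) has_real_derivative G u) (at (u i))"
      using F
    proof induction
      case (base F)
      then show ?case
        using smooth_on_jets_pd smooth_on_jets_has_pd smooth_algebra.base by metis
    next
      case (add F G)
      then obtain F' G' where "F' \<in> smooth_algebra I" "G' \<in> smooth_algebra I"
        "\<forall>u\<in>jets I. ((\<lambda>s. F (u(i := s))) has_real_derivative F' u) (at (u i))"
        "\<forall>u\<in>jets I. ((\<lambda>s. G (u(i := s))) has_real_derivative G' u) (at (u i))"
        by blast
      then show ?case
        by (intro bexI[of _ "\<lambda>u. F' u + G' u"]) (auto simp del: fun_upd_apply intro: DERIV_add smooth_algebra.add)
    next
      case (mult F G)
      then obtain F' G' where *: "F' \<in> smooth_algebra I" "G' \<in> smooth_algebra I"
        "\<forall>u\<in>jets I. ((\<lambda>s. F (u(i := s))) has_real_derivative F' u) (at (u i))"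
        "\<forall>u\<in>jets I. ((\<lambda>s. G (u(i := s))) has_real_derivative G' u) (at (u i))"
        by blast
      show ?case
      proof (intro bexI[of _ "\<lambda>u. F' u * G u + G' u * F u"] ballI)
        fix u assume "u \<in> jets I"
        with * show "((\<lambda>s. F (u(i := s)) * G (u(i := s))) has_real_derivative 
          F' u * G u + G' u * F u) (at (u i))"
          using DERIV_mult[of "\<lambda>s. F (u(i := s))" "F' u" "u i" UNIV "\<lambda>s. G (u(i := s))" "G' u"] by simp
      qed (intro smooth_algebra.intros(2,3) * mult)
    qed
    then show ?thesis
      using pd_eqI by meson
  qed
qed

lemma smooth_on_jets_add:
  "jet_domain I \<Longrightarrow> smooth_on_jets I F \<Longrightarrow> smooth_on_jets I G \<Longrightarrow> smooth_on_jets I (\<lambda>u. F u + G u)"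
  by (rule smooth_algebra_smooth) (auto intro: smooth_algebra.intros)

lemma smooth_on_jets_mult:
  "jet_domain I \<Longrightarrow> smooth_on_jets I F \<Longrightarrow> smooth_on_jets I G \<Longrightarrow> smooth_on_jets I (\<lambda>u. F u * G u)"
  by (rule smooth_algebra_smooth) (auto intro: smooth_algebra.intros)

lemma smooth_on_jets_minus:
  assumes "jet_domain I" "smooth_on_jets I F"
  shows "smooth_on_jets I (\<lambda>u. - F u)"
proof -
  have "smooth_on_jets I (\<lambda>u. - 1 * F u)"
    by (intro smooth_on_jets_mult smooth_on_jets_const assms)
  then show ?thesis by simp
qed

lemma smooth_on_jets_diff:
  "jet_domain I \<Longrightarrow> smooth_on_jets I F \<Longrightarrow> smooth_on_jets I G \<Longrightarrow> smooth_on_jets I (\<lambda>u. F u - G u)"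
  unfolding diff_conv_add_uminus by (intro smooth_on_jets_add smooth_on_jets_minus)

lemmas smooth_on_jets_intros = smooth_on_jets_const smooth_on_jets_coord smooth_on_jets_add
  smooth_on_jets_mult smooth_on_jets_minus smooth_on_jets_diff

lemma jet_smooth_cong:
  assumes "jet_domain I" "\<And>u. u \<in> jets I \<Longrightarrow> F u = G u"
  shows "jet_smooth I m F \<longleftrightarrow> jet_smooth I m G"
  using smooth_on_jets_cong[OF assms] depends_upto_cong[OF assms(2)] by (simp add: jet_smooth_iff)

lemma jet_smooth_mono: "jet_smooth I m F \<Longrightarrow> m \<le> n \<Longrightarrow> jet_smooth I n F"
  using depends_upto_mono by (auto simp: jet_smooth_iff)

lemma jet_smooth_const: "jet_domain I \<Longrightarrow> jet_smooth I m (\<lambda>_. k)"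
  and jet_smooth_coord: "jet_domain I \<Longrightarrow> j \<le> m \<Longrightarrow> jet_smooth I m (\<lambda>u. u j)"
  and jet_smooth_add: "jet_domain I \<Longrightarrow> jet_smooth I m F \<Longrightarrow> jet_smooth I m G \<Longrightarrow>
    jet_smooth I m (\<lambda>u. F u + G u)"
  and jet_smooth_mult: "jet_domain I \<Longrightarrow> jet_smooth I m F \<Longrightarrow> jet_smooth I m G \<Longrightarrow>
    jet_smooth I m (\<lambda>u. F u * G u)"
  and jet_smooth_minus: "jet_domain I \<Longrightarrow> jet_smooth I m F \<Longrightarrow> jet_smooth I m (\<lambda>u. - F u)"
  and jet_smooth_diff: "jet_domain I \<Longrightarrow> jet_smooth I m F \<Longrightarrow> jet_smooth I m G \<Longrightarrow>
    jet_smooth I m (\<lambda>u. F u - G u)"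
  by (simp_all add: jet_smooth_iff depends_upto_intros smooth_on_jets_intros)

lemmas jet_smooth_intros = jet_smooth_const jet_smooth_coord jet_smooth_add
  jet_smooth_mult jet_smooth_minus jet_smooth_diff

lemma jet_smooth_has_pd:
  "jet_smooth I m F \<Longrightarrow> u \<in> jets I \<Longrightarrow>
    ((\<lambda>s. F (u(i := s))) has_real_derivative pd i F u) (at (u i))"
  unfolding jet_smooth_iff by (blast intro: smooth_on_jets_has_pd)

section \<open>Order of a function and its partial derivatives\<close>

lemma pd_eq_0_beyond:
  assumes I: "jet_domain I" and F: "depends_upto I m F" and u: "u \<in> jets I" and "m < i"
  shows "pd i F u = 0"
proof -
  have "pd i F u = pd i (\<lambda>_. F u) u"
    unfolding pd_def
  proof (rule deriv_cong_ev)
    show "\<forall>\<^sub>F s in nhds (u i). F (u(i := s)) = F u"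
      using eventually_jets_upd[OF I u]
      by eventually_elim (rule depends_uptoD[OF F _ u], use \<open>m < i\<close> in auto)
  qed simp
  then show ?thesis
    by (simp add: pd_const)
qed

lemma depends_upto_pd:
  assumes I: "jet_domain I" and F: "depends_upto I m F"
  shows "depends_upto I m (pd i F)"
  unfolding depends_upto_def
proof (intro ballI impI)
  fix u u' assume u: "u \<in> jets I" "u' \<in> jets I" and eq: "\<forall>i\<le>m. u i = u' i"
  show "pd i F u = pd i F u'"
  proof (cases "i \<le> m")
    case True
    have "\<forall>\<^sub>F s in nhds (u i). u'(i := s) \<in> jets I"
      using eventually_jets_upd[OF I u(2), of i] eq True by simp
    with eventually_jets_upd[OF I u(1), of i]
    have "\<forall>\<^sub>F s in nhds (u i). F (u(i := s)) = F (u'(i := s))"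
      by eventually_elim (rule depends_uptoD[OF F], use eq in auto)
    then show ?thesis
      unfolding pd_def using eq True by (intro deriv_cong_ev) auto
  next
    case False
    then show ?thesis
      using pd_eq_0_beyond[OF I F] u by simp
  qed
qed

lemma jet_smooth_pd: "jet_domain I \<Longrightarrow> jet_smooth I m F \<Longrightarrow> jet_smooth I m (pd i F)"
  by (simp add: jet_smooth_iff depends_upto_pd smooth_on_jets_pd)

text \<open>This is where connectedness of the intervals \<open>I i\<close> enters: a vanishing
  derivative makes a function constant on a convex set.\<close>

lemma constant_along_coordinate:
  assumes I: "jet_domain I" and F: "smooth_on_jets I F" and u: "u \<in> jets I" and s: "s \<in> I i"
    and 0: "\<And>u. u \<in> jets I \<Longrightarrow> pd i F u = 0"
  shows "F (u(i := s)) = F u"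
proof -
  have "\<exists>c. \<forall>x\<in>I i. F (u(i := x)) = c"
  proof (rule has_field_derivative_zero_constant)
    show "convex (I i)"
      using I by (simp add: jet_domain_def is_interval_convex)
    show "((\<lambda>x. F (u(i := x))) has_real_derivative 0) (at x within I i)" if "x \<in> I i" for x
      using smooth_on_jets_has_pd[OF F jets_upd[OF u that], of i] 0[OF jets_upd[OF u that]]
      by (simp add: has_field_derivative_at_within)
  qed
  then show ?thesis
    using s jetsD[OF u, of i] by (metis fun_upd_triv)
qed

text \<open>The intermediate jet takes \<open>z_{m+1}\<close> from \<open>u'\<close> and everything
  else from \<open>u\<close>. It differs from \<open>u\<close> only in a coordinate along which
  \<open>F\<close> is constant, and it agrees with \<open>u'\<close> in all coordinates on which
  \<open>F\<close> depends.\<close>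

lemma jet_smooth_reduce:
  assumes I: "jet_domain I" and F: "jet_smooth I (Suc m) F"
    and 0: "\<And>u. u \<in> jets I \<Longrightarrow> pd (Suc m) F u = 0"
  shows "jet_smooth I m F"
proof -
  have "depends_upto I m F"
    unfolding depends_upto_def
  proof (intro ballI impI)
    fix u u' assume u: "u \<in> jets I" "u' \<in> jets I" and eq: "\<forall>i\<le>m. u i = u' i"
    have "F (u(Suc m := u' (Suc m))) = F u"
      using constant_along_coordinate[OF I _ u(1) _ 0] F jetsD[OF u(2)] by (simp add: jet_smooth_iff)
    moreover have "F (u(Suc m := u' (Suc m))) = F u'"
    proof (rule depends_uptoD[of I "Suc m" F])
      show "depends_upto I (Suc m) F"
        using F by (simp add: jet_smooth_iff)
      show "u(Suc m := u' (Suc m)) \<in> jets I"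
        using u by (intro jets_upd jetsD)
      show "(u(Suc m := u' (Suc m))) i = u' i" if "i \<le> Suc m" for i
        using that eq by (cases "i = Suc m") auto
    qed (rule u)
    ultimately show "F u = F u'" by simp
  qed
  with F show ?thesis
    by (simp add: jet_smooth_iff)
qed

section \<open>Total derivatives\<close>

lemma total_derivative_sum:
  assumes "jet_domain I" "jet_smooth I m F" "u \<in> jets I" "m \<le> n"
  shows "(\<Sum>i. w i * pd i F u) = (\<Sum>i\<le>n. w i * pd i F u)"
  using assms by (intro suminf_finite) (auto simp: jet_smooth_iff pd_eq_0_beyond[of I m])

lemma Dx_eq_sum:
  "jet_domain I \<Longrightarrow> jet_smooth I m F \<Longrightarrow> u \<in> jets I \<Longrightarrow> Dx F u = (\<Sum>i\<le>m. u (Suc i) * pd i F u)"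
  unfolding Dx_def by (rule total_derivative_sum) auto

lemma Dt_eq_sum:
  "jet_domain I \<Longrightarrow> jet_smooth I m F \<Longrightarrow> u \<in> jets I \<Longrightarrow> Dt F u v = (\<Sum>i\<le>m. v i * pd i F u)"
  unfolding Dt_def by (rule total_derivative_sum) auto

lemma Dx_cong:
  assumes "jet_domain I" "u \<in> jets I" "\<And>u. u \<in> jets I \<Longrightarrow> F u = G u"
  shows "Dx F u = Dx G u"
  unfolding Dx_def using pd_cong[OF assms] by simp

lemma Dt_cong:
  assumes "jet_domain I" "u \<in> jets I" "\<And>u. u \<in> jets I \<Longrightarrow> F u = G u"
  shows "Dt F u v = Dt G u v"
  unfolding Dt_def using pd_cong[OF assms] by simp

lemma Dx_const: "Dx (\<lambda>_. k) u = 0"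
  by (simp add: Dx_def pd_const)

lemma Dt_const: "Dt (\<lambda>_. k) u v = 0"
  by (simp add: Dt_def pd_const)

lemma jet_smooth_Dx:
  assumes I: "jet_domain I" and F: "jet_smooth I m F"
  shows "jet_smooth I (Suc m) (Dx F)"
proof -
  have "jet_smooth I (Suc m) (\<lambda>u. \<Sum>i\<in>A. u (Suc i) * pd i F u)" if "A \<subseteq> {..m}" for A
    using finite_subset[OF that finite_atMost] that
  proof (induction A rule: finite_induct)
    case empty
    then show ?case by (simp add: jet_smooth_const I)
  next
    case (insert i A)
    then show ?case
      using jet_smooth_mono[OF jet_smooth_pd[OF I F], of "Suc m" i] I
      by (auto intro!: jet_smooth_add jet_smooth_mult jet_smooth_coord)
  qed
  then have "jet_smooth I (Suc m) (\<lambda>u. \<Sum>i\<le>m. u (Suc i) * pd i F u)"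
    by blast
  then show ?thesis
    using jet_smooth_cong[OF I Dx_eq_sum[OF I F]] by simp
qed

text \<open>Hiding the order makes the side conditions of the rules for \<open>Dx\<close> closed
  under all operations, so that the simplifier can discharge them without any computation of
  orders.\<close>

definition finite_order :: "(nat \<Rightarrow> real set) \<Rightarrow> jetfun \<Rightarrow> bool" where
  "finite_order I F \<longleftrightarrow> (\<exists>m. jet_smooth I m F)"

lemma finite_orderI: "jet_smooth I m F \<Longrightarrow> finite_order I F"
  by (auto simp: finite_order_def)

lemma finite_order_common:
  assumes "finite_order I F" "finite_order I G"
  obtains k where "jet_smooth I k F" "jet_smooth I k G"
proof -
  obtain m n where "jet_smooth I m F" "jet_smooth I n G"
    using assms by (auto simp: finite_order_def)
  then show ?thesis
    by (intro that[of "max m n"]) (auto intro: jet_smooth_mono)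
qed

lemma finite_order_const: "jet_domain I \<Longrightarrow> finite_order I (\<lambda>_. k)"
  and finite_order_coord: "jet_domain I \<Longrightarrow> finite_order I (\<lambda>u. u j)"
  and finite_order_minus: "jet_domain I \<Longrightarrow> finite_order I F \<Longrightarrow> finite_order I (\<lambda>u. - F u)"
  and finite_order_Dx: "jet_domain I \<Longrightarrow> finite_order I F \<Longrightarrow> finite_order I (Dx F)"
  unfolding finite_order_def
  using jet_smooth_const jet_smooth_coord[OF _ order_refl] jet_smooth_minus jet_smooth_Dx by blast+

lemma finite_order_add:
    "jet_domain I \<Longrightarrow> finite_order I F \<Longrightarrow> finite_order I G \<Longrightarrow> finite_order I (\<lambda>u. F u + G u)"
  and finite_order_mult:
    "jet_domain I \<Longrightarrow> finite_order I F \<Longrightarrow> finite_order I G \<Longrightarrow> finite_order I (\<lambda>u. F u * G u)"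
  and finite_order_diff:
    "jet_domain I \<Longrightarrow> finite_order I F \<Longrightarrow> finite_order I G \<Longrightarrow> finite_order I (\<lambda>u. F u - G u)"
  by (erule (1) finite_order_common, rule finite_orderI, erule (2) jet_smooth_intros)+

lemma finite_order_divide: "jet_domain I \<Longrightarrow> finite_order I F \<Longrightarrow> finite_order I (\<lambda>u. F u / k)"
  using finite_order_mult[OF _ _ finite_order_const, of I F "inverse k"]
  by (simp add: divide_inverse)

lemmas finite_order_intros = finite_order_const finite_order_coord finite_order_add
  finite_order_mult finite_order_minus finite_order_diff finite_order_divide finite_order_Dx

lemma Dx_add:
  assumes I: "jet_domain I" and u: "u \<in> jets I" and FG: "finite_order I F" "finite_order I G"
  shows "Dx (\<lambda>u. F u + G u) u = Dx F u + Dx G u"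
proof -
  obtain k where FG: "jet_smooth I k F" "jet_smooth I k G"
    using finite_order_common[OF FG] .
  have "pd i (\<lambda>u. F u + G u) u = pd i F u + pd i G u" for i
    using DERIV_add[OF jet_smooth_has_pd[OF FG(1) u] jet_smooth_has_pd[OF FG(2) u], of i]
    by (intro pd_eqI)
  then show ?thesis
    by (simp add: Dx_eq_sum[OF I _ u, of k] FG jet_smooth_add I algebra_simps sum.distrib)
qed

lemma Dx_mult:
  assumes I: "jet_domain I" and u: "u \<in> jets I" and FG: "finite_order I F" "finite_order I G"
  shows "Dx (\<lambda>u. F u * G u) u = Dx F u * G u + F u * Dx G u"
proof -
  obtain k where FG: "jet_smooth I k F" "jet_smooth I k G"
    using finite_order_common[OF FG] .
  have "pd i (\<lambda>u. F u * G u) u = pd i F u * G u + pd i G u * F u" for i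
    using DERIV_mult[OF jet_smooth_has_pd[OF FG(1) u] jet_smooth_has_pd[OF FG(2) u], of i]
    by (intro pd_eqI) simp
  then show ?thesis
    by (simp add: Dx_eq_sum[OF I _ u, of k] FG jet_smooth_mult I algebra_simps sum.distrib
        sum_distrib_left)
qed

lemma Dx_minus:
  assumes I: "jet_domain I" and u: "u \<in> jets I" and F: "finite_order I F"
  shows "Dx (\<lambda>u. - F u) u = - Dx F u"
  using Dx_mult[OF I u finite_order_const[OF I, of "-1"] F] by (simp add: Dx_const)

lemma Dx_diff:
  assumes I: "jet_domain I" and u: "u \<in> jets I" and FG: "finite_order I F" "finite_order I G"
  shows "Dx (\<lambda>u. F u - G u) u = Dx F u - Dx G u"
  using Dx_add[OF I u FG(1) finite_order_minus[OF I FG(2)]] Dx_minus[OF I u FG(2)] by simp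

lemma Dx_divide:
  assumes I: "jet_domain I" and u: "u \<in> jets I" and F: "finite_order I F"
  shows "Dx (\<lambda>u. F u / k) u = Dx F u / k"
  using Dx_mult[OF I u F finite_order_const[OF I, of "inverse k"]]
  by (simp add: Dx_const divide_inverse)

lemma Dx_coord: "Dx (\<lambda>u. u j) u = u (Suc j)"
  unfolding Dx_def pd_coord using suminf_finite[of "{j}" "\<lambda>i. u (Suc i) * (if i = j then 1 else 0)"]
  by simp

lemmas Dx_simps = Dx_const Dx_coord Dx_add Dx_mult Dx_minus Dx_diff Dx_divide

text \<open>
  \<open>D_x F\<close> is affine in the highest derivative \<open>z_{m+1}\<close>, with coefficient \<open>F_{,z_m}\<close>; this is what
  bounds the order of all functions below.
\<close>

lemma pd_eq_0_if_Dx_depends_upto: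
  assumes I: "jet_domain I" and F: "jet_smooth I m F" and D: "depends_upto I m (Dx F)"
    and u: "u \<in> jets I"
  shows "pd m F u = 0"
proof -
  obtain s where s: "s \<in> I (Suc m)" "s \<noteq> u (Suc m)"
    using jet_domain_other[OF I jetsD[OF u]] by blast
  define u' where "u' = u(Suc m := s)"
  have u': "u' \<in> jets I"
    using u s by (simp add: u'_def jets_upd)
  have pd: "pd i F u' = pd i F u" for i
    using F by (intro depends_uptoD[OF depends_upto_pd[OF I]] u u') (auto simp: jet_smooth_iff u'_def)
  have "Dx F u' - Dx F u = (\<Sum>i\<le>m. (u' (Suc i) - u (Suc i)) * pd i F u)"
    using u u' by (simp add: Dx_eq_sum[OF I F] pd sum_subtractf left_diff_distrib)
  also have "\<dots> = (\<Sum>i\<in>{m}. (u' (Suc i) - u (Suc i)) * pd i F u)"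
    by (intro sum.mono_neutral_right) (auto simp: u'_def)
  finally have "Dx F u' - Dx F u = (s - u (Suc m)) * pd m F u"
    by (simp add: u'_def)
  moreover have "Dx F u' = Dx F u"
    by (rule depends_uptoD[OF D u' u]) (simp add: u'_def)
  ultimately show ?thesis
    using s by simp
qed

lemma jet_smooth_reduce_Dx:
  assumes "jet_domain I" "jet_smooth I (Suc m) F" "depends_upto I (Suc m) (Dx F)"
  shows "jet_smooth I m F"
  by (rule jet_smooth_reduce[OF assms(1,2) pd_eq_0_if_Dx_depends_upto[OF assms]])

text \<open>The descent lowers the order by one per step, starting from an arbitrary
  \<open>k\<close>. The hypothesis on \<open>Dx F\<close> is therefore needed at each order
  \<open>m > n\<close>, and it may use that \<open>F\<close> already has order
  \<open>m\<close>.\<close>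

lemma jet_smooth_reduce_Dx_upto:
  assumes I: "jet_domain I" and "jet_smooth I k F"
    and "\<And>m. n < m \<Longrightarrow> jet_smooth I m F \<Longrightarrow> depends_upto I m (Dx F)"
  shows "jet_smooth I n F"
  using assms(2)
proof (induction k)
  case 0
  then show ?case by (rule jet_smooth_mono) simp
next
  case (Suc k)
  show ?case
  proof (cases "n < Suc k")
    case True
    then show ?thesis
      using Suc jet_smooth_reduce_Dx[OF I Suc.prems assms(3)[OF True Suc.prems]] by blast
  next
    case False
    then show ?thesis
      using jet_smooth_mono[OF Suc.prems] by simp
  qed
qed

lemma constant_if_pd_0:
  assumes I: "jet_domain I" and F: "jet_smooth I 0 F" and 0: "\<And>u. u \<in> jets I \<Longrightarrow> pd 0 F u = 0"
    and u: "u \<in> jets I" "u' \<in> jets I"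
  shows "F u = F u'"
proof -
  have "F (u(0 := u' 0)) = F u"
    using F constant_along_coordinate[OF I _ u(1) jetsD[OF u(2)] 0] by (simp add: jet_smooth_iff)
  moreover have "F (u(0 := u' 0)) = F u'"
  proof (rule depends_uptoD[of I 0 F])
    show "depends_upto I 0 F"
      using F by (simp add: jet_smooth_iff)
    show "u(0 := u' 0) \<in> jets I"
      using u by (intro jets_upd jetsD)
  qed (use u in simp_all)
  ultimately show ?thesis by simp
qed

text \<open>Here the bound on \<open>Dx F\<close> also holds for \<open>m = 0\<close>, so that after
  the descent to order zero one further step gives \<open>F_{,z} = 0\<close>.\<close>

lemma constant_if_Dx_depends_upto:
  assumes I: "jet_domain I" and F: "jet_smooth I k F"
    and D: "\<And>m. jet_smooth I m F \<Longrightarrow> depends_upto I m (Dx F)"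
  shows "\<exists>k. \<forall>u\<in>jets I. F u = k"
proof -
  have F0: "jet_smooth I 0 F"
    using jet_smooth_reduce_Dx_upto[OF I F] D by blast
  obtain u0 where u0: "u0 \<in> jets I"
    using jets_nonempty[OF I] by blast
  then have "F u = F u0" if "u \<in> jets I" for u
    using constant_if_pd_0[OF I F0 _ that u0] pd_eq_0_if_Dx_depends_upto[OF I F0 D[OF F0]] by blast
  then show ?thesis
    by blast
qed

section \<open>Generic inequalities\<close>

text \<open>Continuity yields a basic open set of the product topology around \<open>u\<close> on
  which \<open>F\<close> does not vanish. A box of balls inside it suffices: such a box need not be
  open in the product topology, but \<open>jet_domain\<close> only asks that each factor be an open
  interval.\<close>

lemma generically_nonzeroI:
  assumes I: "jet_domain I" and F: "continuous_on (jets I) F" and u: "u \<in> jets I" "F u \<noteq> 0"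
  shows "generically_nonzero I F"
proof -
  obtain T where T: "open T" "T \<inter> jets I = F -` (- {0}) \<inter> jets I"
    using F unfolding continuous_on_open_invariant by (metis open_Compl closed_singleton)
  then have "u \<in> T"
    using u by blast
  then obtain X where X: "u \<in> (\<Pi>\<^sub>E i\<in>UNIV. X i)" "\<And>i. open (X i)" "(\<Pi>\<^sub>E i\<in>UNIV. X i) \<subseteq> T"
    using product_topology_open_contains_basis[of "\<lambda>_. euclidean" UNIV T u] T(1)
    by (auto simp: open_fun_def)
  have "\<exists>e>0. ball (u i) e \<subseteq> X i \<inter> I i" for i
    using X I u(1) by (intro open_contains_ball[THEN iffD1, rule_format])
      (auto simp: jet_domain_def jets_def open_Int PiE_def Pi_def)
  then obtain e where e: "\<And>i. e i > 0" "\<And>i. ball (u i) (e i) \<subseteq> X i \<inter> I i"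
    by metis
  have "jet_domain (\<lambda>i. ball (u i) (e i))"
    by (simp add: jet_domain_def is_interval_convex_1 not_le e(1))
  moreover have "F u' \<noteq> 0" if "u' \<in> jets (\<lambda>i. ball (u i) (e i))" for u'
  proof -
    have "u' \<in> (\<Pi>\<^sub>E i\<in>UNIV. X i) \<and> u' \<in> jets I"
      using that e(2) unfolding jets_def by (simp add: PiE_def Pi_def subset_eq)
    then show ?thesis
      using X(3) T(2) by blast
  qed
  ultimately show ?thesis
    unfolding generically_nonzero_def using e(2) by blast
qed

lemma generically_nonzeroE:
  assumes "generically_nonzero I F"
  obtains u where "u \<in> jets I" "F u \<noteq> 0"
proof -
  obtain J where J: "jet_domain J" "\<forall>i. J i \<subseteq> I i" "\<forall>u\<in>jets J. F u \<noteq> 0"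
    using assms by (auto simp: generically_nonzero_def)
  then obtain u where "u \<in> jets J"
    using jets_nonempty by blast
  with J show ?thesis
    by (intro that[of u]) (auto simp: jets_def)
qed

lemma generically_nonzero_cong:
  assumes "\<And>u. u \<in> jets I \<Longrightarrow> F u \<noteq> 0 \<Longrightarrow> G u \<noteq> 0" "generically_nonzero I F"
  shows "generically_nonzero I G"
proof -
  obtain J where J: "jet_domain J" "\<forall>i. J i \<subseteq> I i" "\<forall>u\<in>jets J. F u \<noteq> 0"
    using assms(2) by (auto simp: generically_nonzero_def)
  moreover have "u \<in> jets I" if "u \<in> jets J" for u
    using that J by (auto simp: jets_def)
  ultimately show ?thesis
    unfolding generically_nonzero_def using assms(1) by blast
qed

section \<open>Linear coordinate transformations\<close>

lemma old_coord_has_derivative: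
  "c \<noteq> 0 \<Longrightarrow> (old_coord a c c0 i has_real_derivative a ^ i / c) (at s)"
  unfolding old_coord_def by (cases "i = 0") (auto intro!: derivative_eq_intros)

lemma old_coord_continuous: "c \<noteq> 0 \<Longrightarrow> continuous_on UNIV (old_coord a c c0 i)"
  by (rule DERIV_continuous_on[OF DERIV_subset[OF old_coord_has_derivative]]) auto

text \<open>Solving \<open>z' = c z + c0\<close> gives \<open>z = z' / c - c0 / c\<close>, hence the
  parameters \<open>1 / a\<close>, \<open>1 / c\<close> and \<open>- (c0 / c)\<close> of the inverse
  transformation.\<close>

lemma old_coord_inverse:
  assumes "a \<noteq> 0" "c \<noteq> 0"
  shows "old_coord a c c0 i (old_coord (1 / a) (1 / c) (- (c0 / c)) i s) = s"
    and "old_coord (1 / a) (1 / c) (- (c0 / c)) i (old_coord a c c0 i s) = s"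
  using assms by (auto simp: old_coord_def field_simps power_divide)

lemma jets_tr_domain:
  "u \<in> jets (tr_domain a c c0 I) \<longleftrightarrow> (\<lambda>i. old_coord a c c0 i (u i)) \<in> jets I"
  by (simp add: jets_def tr_domain_def)

lemma jet_domain_tr_domain:
  assumes I: "jet_domain I" and ac: "a \<noteq> 0" "c \<noteq> 0"
  shows "jet_domain (tr_domain a c c0 I)"
  unfolding jet_domain_def
proof (intro allI conjI)
  fix i
  have Ii: "open (I i)" "is_interval (I i)" "I i \<noteq> {}"
    using I by (auto simp: jet_domain_def)
  have eq: "tr_domain a c c0 I i = old_coord a c c0 i -` I i"
    by (auto simp: tr_domain_def)
  show "open (tr_domain a c c0 I i)"
    unfolding eq using Ii(1) old_coord_continuous[OF ac(2)] by (metis open_vimage)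
  show "tr_domain a c c0 I i \<noteq> {}"
    unfolding eq using Ii(3) old_coord_inverse(1)[OF ac] by (metis ex_in_conv vimageI2)
  show "is_interval (tr_domain a c c0 I i)"
    unfolding is_interval_1
  proof (intro ballI allI impI)
    fix s t x
    assume st: "s \<in> tr_domain a c c0 I i" "t \<in> tr_domain a c c0 I i" and x: "s \<le> x \<and> x \<le> t"
    define k where "k = a ^ i / c"
    define d where "d = (if i = 0 then - k * c0 else 0)"
    have oc: "old_coord a c c0 i y = k * y + d" for y
      by (simp add: old_coord_def k_def d_def diff_divide_distrib)
    \<comment> \<open>The affine map \<open>old_coord\<close> reverses the order when
      \<open>a ^ i / c\<close> is negative, so the image of \<open>x\<close> lies between the images
      of \<open>s\<close> and \<open>t\<close> in one of two orders.\<close>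
    have "(k * s + d \<le> k * x + d \<and> k * x + d \<le> k * t + d) \<or>
      (k * t + d \<le> k * x + d \<and> k * x + d \<le> k * s + d)"
      using x by (cases "k \<ge> 0") (auto simp: mult_left_mono mult_left_mono_neg)
    then show "x \<in> tr_domain a c c0 I i"
      using st Ii(2) unfolding is_interval_1 tr_domain_def oc by blast
  qed
qed

lemma tr_fun_has_pd:
  assumes F: "smooth_on_jets I F" and c: "c \<noteq> 0" and u: "u \<in> jets (tr_domain a c c0 I)"
  shows "((\<lambda>s. tr_fun a c c0 F (u(i := s))) has_real_derivative
    a ^ i / c * tr_fun a c c0 (pd i F) u) (at (u i))"
proof -
  define U where "U = (\<lambda>i. old_coord a c c0 i (u i))"
  have "U \<in> jets I"
    using u by (simp add: jets_tr_domain U_def)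
  from smooth_on_jets_has_pd[OF F this, of i]
  have "((\<lambda>s. F (U(i := old_coord a c c0 i s))) has_real_derivative
      pd i F U * (a ^ i / c)) (at (u i))"
    by (intro DERIV_chain2[where f = "\<lambda>s. F (U(i := s))"] old_coord_has_derivative c) (simp add: U_def)
  moreover have "(\<lambda>j. old_coord a c c0 j ((u(i := s)) j)) = U(i := old_coord a c c0 i s)" for s
    by (auto simp: U_def)
  ultimately show ?thesis
    by (simp add: tr_fun_def U_def mult.commute)
qed

lemma pd_tr_fun:
  assumes "smooth_on_jets I F" "c \<noteq> 0" "u \<in> jets (tr_domain a c c0 I)"
  shows "pd i (tr_fun a c c0 F) u = a ^ i / c * tr_fun a c c0 (pd i F) u"
  by (rule pd_eqI[OF tr_fun_has_pd[OF assms]])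

text \<open>By the chain rule a partial derivative of a transformed function is again a transformed
  function, up to the factor \<open>a ^ i / c\<close>. Allowing scalar multiples makes the set
  closed under \<open>pd\<close>.\<close>

lemma smooth_on_jets_tr_fun:
  assumes I: "jet_domain I" and F: "smooth_on_jets I F" and ac: "a \<noteq> 0" "c \<noteq> 0"
  shows "smooth_on_jets (tr_domain a c c0 I) (tr_fun a c c0 F)"
proof (rule smooth_on_jets_coinduct[OF jet_domain_tr_domain[OF I ac],
      of _ "{\<lambda>u. k * tr_fun a c c0 F u | k F. smooth_on_jets I F}"])
  show "tr_fun a c c0 F \<in> {\<lambda>u. k * tr_fun a c c0 F u | k F. smooth_on_jets I F}"
    using F by (intro CollectI exI[of _ 1]) auto
next
  fix G assume "G \<in> {\<lambda>u. k * tr_fun a c c0 F u | k F. smooth_on_jets I F}"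
  then obtain k F where G: "G = (\<lambda>u. k * tr_fun a c c0 F u)" and F: "smooth_on_jets I F"
    by blast
  have "continuous_on (jets (tr_domain a c c0 I)) (\<lambda>u. F (\<lambda>i. old_coord a c c0 i (u i)))"
  proof (rule continuous_on_compose2[OF smooth_on_jets_continuous[OF F]])
    show "continuous_on (jets (tr_domain a c c0 I)) (\<lambda>u i. old_coord a c c0 i (u i))"
      by (intro continuous_on_coordinatewise_then_product
          continuous_on_compose2[OF old_coord_continuous[OF ac(2)]]
          continuous_on_subset[OF continuous_on_product_coordinates]) auto
  qed (auto simp: jets_tr_domain)
  then show "continuous_on (jets (tr_domain a c c0 I)) G"
    unfolding G tr_fun_def by (intro continuous_intros)
  have D: "((\<lambda>s. G (u(i := s))) has_real_derivative
    (k * (a ^ i / c)) * tr_fun a c c0 (pd i F) u) (at (u i))"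
    if "u \<in> jets (tr_domain a c c0 I)" for u i
    unfolding G using DERIV_cmult[OF tr_fun_has_pd[OF F ac(2) that, of i], of k] by (simp add: mult.assoc)
  show "(\<lambda>s. G (u(i := s))) differentiable at (u i)"
    if "u \<in> jets (tr_domain a c c0 I)" for u i
    using D[OF that, of i] real_differentiable_def by blast
  have "pd i G u = (k * (a ^ i / c)) * tr_fun a c c0 (pd i F) u"
    if "u \<in> jets (tr_domain a c c0 I)" for u i
    using D[OF that, of i] by (rule pd_eqI)
  then show "\<exists>H\<in>{\<lambda>u. k * tr_fun a c c0 F u | k F. smooth_on_jets I F}.
    \<forall>u\<in>jets (tr_domain a c c0 I). pd i G u = H u" for i
    using smooth_on_jets_pd[OF F, of i]
    by (intro bexI[of _ "\<lambda>u. k * (a ^ i / c) * tr_fun a c c0 (pd i F) u"]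
        CollectI exI[of _ "k * (a ^ i / c)"] exI[of _ "pd i F"]) simp_all
qed

lemma jet_smooth_tr_fun:
  assumes I: "jet_domain I" and F: "jet_smooth I m F" and ac: "a \<noteq> 0" "c \<noteq> 0"
  shows "jet_smooth (tr_domain a c c0 I) m (tr_fun a c c0 F)"
  unfolding jet_smooth_iff
proof
  show "depends_upto (tr_domain a c c0 I) m (tr_fun a c c0 F)"
    unfolding depends_upto_def tr_fun_def
    using F by (intro ballI impI depends_uptoD[of I m F]) (auto simp: jet_smooth_iff jets_tr_domain)
  show "smooth_on_jets (tr_domain a c c0 I) (tr_fun a c c0 F)"
    using F by (intro smooth_on_jets_tr_fun I ac) (simp add: jet_smooth_iff)
qed

text \<open>The chain rule factor of \<open>z_i\<close> and the new coordinate
  \<open>z'_{i+1}\<close> combine to \<open>a ^ i / c * z'_{i+1} = z_{i+1} / a\<close>. The shift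
  \<open>c0\<close> does not appear because it affects \<open>z_0\<close> only.\<close>

lemma Dx_tr_fun:
  assumes I: "jet_domain I" and F: "jet_smooth I m F" and ac: "a \<noteq> 0" "c \<noteq> 0"
    and u: "u \<in> jets (tr_domain a c c0 I)"
  shows "Dx (tr_fun a c c0 F) u = Dx F (\<lambda>i. old_coord a c c0 i (u i)) / a"
proof -
  have "smooth_on_jets I F"
    using F by (simp add: jet_smooth_iff)
  then show ?thesis
    using u ac by (simp add: Dx_eq_sum[OF jet_domain_tr_domain[OF I ac] jet_smooth_tr_fun[OF I F ac]]
        Dx_eq_sum[OF I F] jets_tr_domain pd_tr_fun sum_divide_distrib)
      (simp add: tr_fun_def old_coord_def mult_ac)
qed

text \<open>The second sequence on the right is the old value of the t-derivatives,
  \<open>z_{it} = (b a^i / c) z'_{it'}\<close>.\<close>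

lemma Dt_tr_fun:
  assumes I: "jet_domain I" and F: "jet_smooth I m F" and abc: "a \<noteq> 0" "b \<noteq> 0" "c \<noteq> 0"
    and u: "u \<in> jets (tr_domain a c c0 I)"
  shows "Dt (tr_fun a c c0 F) u v =
    Dt F (\<lambda>i. old_coord a c c0 i (u i)) (\<lambda>i. b * a ^ i / c * v i) / b"
proof -
  have "smooth_on_jets I F"
    using F by (simp add: jet_smooth_iff)
  then show ?thesis
    using u abc by (simp add: Dt_eq_sum[OF jet_domain_tr_domain[OF I abc(1,3)]
          jet_smooth_tr_fun[OF I F abc(1,3)]]
        Dt_eq_sum[OF I F] jets_tr_domain pd_tr_fun sum_divide_distrib)
      (simp add: tr_fun_def mult_ac)
qed

lemma tr_forms_eq:
  "tr_forms a b c c0 f i j = (\<lambda>u. 1 / (if j = 1 then a else b) * tr_fun a c c0 (f i j) u)"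
  by (auto simp: tr_forms_def)

lemma structure_equations_iff:
  "structure_equations \<delta> (assoc_form f 1) (assoc_form f 2) (assoc_form f 3) u v \<longleftrightarrow>
     Dx (f 1 2) u - Dt (f 1 1) u v = f 3 1 u * f 2 2 u - f 3 2 u * f 2 1 u \<and>
     Dx (f 2 2) u - Dt (f 2 1) u v = f 1 1 u * f 3 2 u - f 1 2 u * f 3 1 u \<and>
     Dx (f 3 2) u - Dt (f 3 1) u v = \<delta> * (f 1 1 u * f 2 2 u - f 1 2 u * f 2 1 u)"
  by (simp add: structure_equations_def ext_d_def wedge_def assoc_form_def)

text \<open>Both sides of each structure equation are coefficients of \<open>dx \<and> dt\<close>,
  so all of them are divided by \<open>a * b\<close>; the third order equation is multiplied by
  \<open>c / b\<close>. Nonzero factors preserve the equivalence at corresponding points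
  \<open>(u, v)\<close> and \<open>(U, V)\<close>.\<close>

lemma describes_tr:
  assumes I: "jet_domain I" and abc: "a \<noteq> 0" "b \<noteq> 0" "c \<noteq> 0"
    and D: "describes I \<delta> (third_order_eq lam A B) f"
  shows "describes (tr_domain a c c0 I) \<delta>
    (third_order_eq (tr_lam a lam) (tr_A a b c c0 A) (tr_B a b c c0 B)) (tr_forms a b c c0 f)"
proof -
  note I' = jet_domain_tr_domain[OF I abc(1,3), of c0]
  obtain k where f: "jet_smooth I k (f i j)" if "i \<in> {1..3}" "j \<in> {1..2}" for i j
    using D unfolding describes_def by blast
  have f': "jet_smooth (tr_domain a c c0 I) k (tr_forms a b c c0 f i j)"
    if "i \<in> {1..3}" "j \<in> {1..2}" for i j
    unfolding tr_forms_eq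
    by (intro jet_smooth_mult jet_smooth_const jet_smooth_tr_fun f[OF that] I I' abc)
  have eqs: "third_order_eq (tr_lam a lam) (tr_A a b c c0 A) (tr_B a b c c0 B) u v \<longleftrightarrow>
    structure_equations \<delta> (assoc_form (tr_forms a b c c0 f) 1) (assoc_form (tr_forms a b c c0 f) 2)
      (assoc_form (tr_forms a b c c0 f) 3) u v"
    if u: "u \<in> jets (tr_domain a c c0 I)" for u v
  proof -
    define U V where "U = (\<lambda>i. old_coord a c c0 i (u i))" and "V = (\<lambda>i. b * a ^ i / c * v i)"
    have U: "U \<in> jets I"
      using u by (simp add: U_def jets_tr_domain)
    have f_eq: "tr_forms a b c c0 f i j u = f i j U / (if j = 1 then a else b)" for i j
      by (simp add: tr_forms_def tr_fun_def U_def)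
    have Dx_eq: "Dx (tr_forms a b c c0 f i 2) u = Dx (f i 2) U / (a * b)" if i: "i \<in> {1..3}" for i
    proof -
      have "jet_smooth I k (f i 2)"
        using f i by simp
      then show ?thesis
        using Dx_mult[OF I' u finite_order_const[OF I', of "1 / b"]
            finite_orderI[OF jet_smooth_tr_fun[OF I _ abc(1,3)]], of k "f i 2"]
          Dx_tr_fun[OF I _ abc(1,3) u, of k "f i 2"]
        by (simp add: tr_forms_eq U_def Dx_const mult.commute)
    qed
    have Dt_eq: "Dt (tr_forms a b c c0 f i 1) u v = Dt (f i 1) U V / (a * b)"
      if i: "i \<in> {1..3}" for i
    proof -
      have f1: "jet_smooth I k (f i 1)"
        using f i by simp
      have tf: "jet_smooth (tr_domain a c c0 I) k (tr_fun a c c0 (f i 1))"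
        by (rule jet_smooth_tr_fun[OF I f1 abc(1,3)])
      have "pd n (tr_forms a b c c0 f i 1) u = 1 / a * pd n (tr_fun a c c0 (f i 1)) u" for n
        using DERIV_cmult[OF jet_smooth_has_pd[OF tf u, of n], of "1 / a"]
        by (intro pd_eqI) (simp add: tr_forms_eq)
      then have "Dt (tr_forms a b c c0 f i 1) u v = Dt (tr_fun a c c0 (f i 1)) u v / a"
        using f'[of i 1] i
        by (simp add: Dt_eq_sum[OF I' _ u, of k] Dt_eq_sum[OF I' tf u] sum_divide_distrib
            del: One_nat_def)
      then show ?thesis
        using Dt_tr_fun[OF I f1 abc u] by (simp add: U_def V_def mult.commute)
    qed
    have "structure_equations \<delta> (assoc_form (tr_forms a b c c0 f) 1)
        (assoc_form (tr_forms a b c c0 f) 2) (assoc_form (tr_forms a b c c0 f) 3) u v \<longleftrightarrow>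
      structure_equations \<delta> (assoc_form f 1) (assoc_form f 2) (assoc_form f 3) U V"
      unfolding structure_equations_iff using abc
      by (simp add: f_eq Dx_eq Dt_eq[unfolded One_nat_def] mult.commute[of b a]
          flip: diff_divide_distrib)
    moreover have "third_order_eq (tr_lam a lam) (tr_A a b c c0 A) (tr_B a b c c0 B) u v \<longleftrightarrow>
      third_order_eq lam A B U V"
    proof -
      have "V 0 - lam * V 2 = b / c * (v 0 - tr_lam a lam * v 2)"
        using abc by (simp add: V_def tr_lam_def field_simps)
      moreover have "A U * U 3 + B U = b / c * (tr_A a b c c0 A u * u 3 + tr_B a b c c0 B u)"
        using abc by (simp add: tr_A_def tr_B_def tr_fun_def U_def[symmetric] field_simps)
          (simp add: U_def old_coord_def)
      ultimately show ?thesis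
        using abc by (simp add: third_order_eq_def)
    qed
    ultimately show ?thesis
      using D U by (simp add: describes_def)
  qed
  obtain J where J: "jet_domain J" "\<forall>i. J i \<subseteq> I i"
    "\<forall>u\<in>jets J. wedge (assoc_form f 1) (assoc_form f 2) u \<noteq> 0"
    using D by (auto simp: describes_def generically_nonzero_def)
  have "generically_nonzero (tr_domain a c c0 I)
    (wedge (assoc_form (tr_forms a b c c0 f) 1) (assoc_form (tr_forms a b c c0 f) 2))"
    unfolding generically_nonzero_def
  proof (intro exI[of _ "tr_domain a c c0 J"] conjI ballI allI)
    show "jet_domain (tr_domain a c c0 J)"
      by (rule jet_domain_tr_domain[OF J(1) abc(1,3)])
    show "tr_domain a c c0 J i \<subseteq> tr_domain a c c0 I i" for i
      using J(2) by (auto simp: tr_domain_def)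
    fix u assume "u \<in> jets (tr_domain a c c0 J)"
    then show "wedge (assoc_form (tr_forms a b c c0 f) 1) (assoc_form (tr_forms a b c c0 f) 2) u \<noteq> 0"
      using J(3)[rule_format, of "\<lambda>i. old_coord a c c0 i (u i)"] abc
      by (simp add: jets_tr_domain wedge_def assoc_form_def tr_forms_def tr_fun_def field_simps)
  qed
  with f' eqs show ?thesis
    unfolding describes_def by blast
qed

text \<open>The quadratic condition survives because it is homogeneous and both
  \<open>z\<close>-derivatives acquire the same factor \<open>1 / (a * c)\<close>.\<close>

lemma admissible_tr:
  assumes I: "jet_domain I" and abc: "a \<noteq> 0" "b \<noteq> 0" "c \<noteq> 0"
    and f: "\<exists>k. \<forall>i\<in>{1..3}. \<forall>j\<in>{1..2}. jet_smooth I k (f i j)" and adm: "admissible I \<delta> f"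
  shows "admissible (tr_domain a c c0 I) \<delta> (tr_forms a b c c0 f)"
proof -
  obtain k where f: "jet_smooth I k (f i j)" if "i \<in> {1..3}" "j \<in> {1..2}" for i j
    using f by blast
  have "constant_on_jets (tr_domain a c c0 I) (tr_forms a b c c0 f 1 1)"
  proof -
    obtain \<eta> where "\<And>u. u \<in> jets I \<Longrightarrow> f 1 1 u = \<eta>"
      using adm by (auto simp: admissible_def constant_on_jets_def)
    then show ?thesis
      unfolding constant_on_jets_def
      by (intro exI[of _ "\<eta> / a"]) (simp add: tr_forms_def tr_fun_def jets_tr_domain)
  qed
  moreover have "affine_in_z_z2 (tr_domain a c c0 I) (tr_forms a b c c0 f i 1)"
    if affine: "affine_in_z_z2 I (f i 1)" for i
  proof -
    obtain p q r where "\<forall>u\<in>jets I. f i 1 u = p * u 0 + q * u 2 + r"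
      using affine unfolding affine_in_z_z2_def by blast
    then show ?thesis
      unfolding affine_in_z_z2_def using abc
      by (intro exI[of _ "p / (a * c)"] exI[of _ "a * q / c"] exI[of _ "(r - p * c0 / c) / a"])
        (simp add: tr_forms_def tr_fun_def jets_tr_domain old_coord_def field_simps power2_eq_square)
  qed
  moreover have "pd 0 (tr_forms a b c c0 f i 1) u =
      1 / (a * c) * pd 0 (f i 1) (\<lambda>i. old_coord a c c0 i (u i))"
    if u: "u \<in> jets (tr_domain a c c0 I)" and i: "i \<in> {1..3}" for i u
  proof -
    have "smooth_on_jets I (f i 1)"
      using f i by (simp add: jet_smooth_iff)
    from DERIV_cmult[OF tr_fun_has_pd[OF this abc(3) u, of 0], of "1 / a"]
    show ?thesis
      by (intro pd_eqI) (simp add: tr_forms_eq tr_fun_def)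
  qed
  ultimately show ?thesis
    using adm unfolding admissible_def
    by (simp add: jets_tr_domain power_mult_distrib power_divide mult.left_commute
        flip: right_diff_distrib)
qed

text \<open>With this, the transfer lemmas for a transformation also carry properties back to the
  original coordinates.\<close>

lemma tr_inverse:
  assumes "a \<noteq> 0" "b \<noteq> 0" "c \<noteq> 0"
  shows "tr_domain (1 / a) (1 / c) (- (c0 / c)) (tr_domain a c c0 I) = I"
    and "tr_lam (1 / a) (tr_lam a lam) = lam"
    and "tr_A (1 / a) (1 / b) (1 / c) (- (c0 / c)) (tr_A a b c c0 A) = A"
    and "tr_B (1 / a) (1 / b) (1 / c) (- (c0 / c)) (tr_B a b c c0 B) = B"
    and "tr_forms (1 / a) (1 / b) (1 / c) (- (c0 / c)) (tr_forms a b c c0 f) = f"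
  using assms
  by (auto simp: fun_eq_iff tr_domain_def tr_lam_def tr_A_def tr_B_def tr_forms_def tr_fun_def
      old_coord_inverse field_simps)

lemma describes_admissible_of_tr:
  fixes f :: "nat \<Rightarrow> nat \<Rightarrow> jetfun"
  assumes I: "jet_domain I" and abc: "a \<noteq> 0" "b \<noteq> 0" "c \<noteq> 0"
    and D: "describes (tr_domain a c c0 I) \<delta>
      (third_order_eq (tr_lam a lam) (tr_A a b c c0 A) (tr_B a b c c0 B)) g"
    and adm: "admissible (tr_domain a c c0 I) \<delta> g"
  defines "f \<equiv> tr_forms (1 / a) (1 / b) (1 / c) (- (c0 / c)) g"
  shows "describes I \<delta> (third_order_eq lam A B) f \<and> admissible I \<delta> f"
proof -
  have abc': "1 / a \<noteq> 0" "1 / b \<noteq> 0" "1 / c \<noteq> 0"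
    using abc by auto
  note I' = jet_domain_tr_domain[OF I abc(1,3), of c0]
  have "\<exists>k. \<forall>i\<in>{1..3}. \<forall>j\<in>{1..2}. jet_smooth (tr_domain a c c0 I) k (g i j)"
    using D by (simp add: describes_def)
  then show ?thesis
    using describes_tr[OF I' abc' D, of "- (c0 / c)"] admissible_tr[OF I' abc' _ adm, of "- (c0 / c)"]
    unfolding f_def tr_inverse[OF abc] by blast
qed

section \<open>The normal forms describe pseudospherical surfaces\<close>

lemma affine_has_pd:
  fixes u :: jet
  shows "((\<lambda>s. p * (u(i := s)) 0 + q * (u(i := s)) 2 + r) has_real_derivative
    (if i = 0 then p else if i = 2 then q else 0)) (at (u i))"
  by (cases "i = 0"; cases "i = 2") (auto intro!: derivative_eq_intros)

lemma pd_affine: "pd i (\<lambda>u. p * u 0 + q * u 2 + r) u = (if i = 0 then p else if i = 2 then q else 0)"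
  by (rule pd_eqI[OF affine_has_pd])

lemma pd_affine_cong:
  assumes I: "jet_domain I" and u: "u \<in> jets I" and F: "\<And>u. u \<in> jets I \<Longrightarrow> F u = p * u 0 + q * u 2 + r"
  shows "pd i F u = (if i = 0 then p else if i = 2 then q else 0)"
proof -
  have "pd i F u = pd i (\<lambda>u. p * u 0 + q * u 2 + r) u"
    by (rule pd_cong[OF I u F])
  then show ?thesis
    by (simp add: pd_affine)
qed

lemma jet_smooth_affine:
  "jet_domain I \<Longrightarrow> 2 \<le> m \<Longrightarrow> jet_smooth I m (\<lambda>u. p * u 0 + q * u 2 + r)"
  by (intro jet_smooth_intros) auto

lemma Dt_affine:
  assumes I: "jet_domain I" and u: "u \<in> jets I" and F: "\<And>u. u \<in> jets I \<Longrightarrow> F u = p * u 0 + q * u 2 + r"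
  shows "Dt F u v = p * v 0 + q * v 2"
proof -
  have "Dt F u v = Dt (\<lambda>u. p * u 0 + q * u 2 + r) u v"
    by (rule Dt_cong[OF I u F])
  also have "\<dots> = (\<Sum>i\<le>2. v i * pd i (\<lambda>u. p * u 0 + q * u 2 + r) u)"
    by (rule Dt_eq_sum[OF I jet_smooth_affine[OF I order_refl] u])
  also have "\<dots> = p * v 0 + q * v 2"
    unfolding pd_affine by (simp add: numeral_2_eq_2 atMost_Suc)
  finally show ?thesis .
qed

text \<open>Since \<open>\<omega>3 = \<epsilon> \<omega>2\<close> and \<open>\<omega>1\<close> has
  constant coefficients, the first structure equation reads \<open>0 = 0\<close>, and the third is
  \<open>\<epsilon>\<close> times the second, which is the PDE. The coefficient of
  \<open>\<omega>1 \<and> \<omega>2\<close> is \<open>- \<epsilon> (a \<psi> + b w)\<close>, so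
  nondegeneracy is the inequality required in the form.\<close>

lemma form_I_describes:
  assumes I: "jet_domain I" and form: "form_I I lam A B g"
  shows "describes I 1 (third_order_eq lam A B) g \<and> admissible I 1 g"
proof -
  obtain \<epsilon> a b :: real and \<psi> where \<epsilon>: "\<epsilon> \<in> {1, -1}" and \<psi>: "jet_smooth I 2 \<psi>"
    and gen: "generically_nonzero I (\<lambda>u. a * \<psi> u + b * (u 0 - lam * u 2))"
    and eq: "\<And>u. u \<in> jets I \<Longrightarrow> A u * u 3 + B u = Dx \<psi> u + a * \<psi> u + b * (u 0 - lam * u 2)"
    and g11: "\<And>u. u \<in> jets I \<Longrightarrow> g 1 1 u = - \<epsilon> * a"
    and g12: "\<And>u. u \<in> jets I \<Longrightarrow> g 1 2 u = \<epsilon> * b"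
    and g21: "\<And>u. u \<in> jets I \<Longrightarrow> g 2 1 u = u 0 - lam * u 2"
    and g22: "\<And>u. u \<in> jets I \<Longrightarrow> g 2 2 u = \<psi> u"
    and g31: "\<And>u. u \<in> jets I \<Longrightarrow> g 3 1 u = \<epsilon> * g 2 1 u"
    and g32: "\<And>u. u \<in> jets I \<Longrightarrow> g 3 2 u = \<epsilon> * g 2 2 u"
    using form unfolding form_I_def Let_def by blast
  have \<epsilon>2: "\<epsilon> * \<epsilon> = 1"
    using \<epsilon> by auto
  have g21': "g 2 1 u = 1 * u 0 + (- lam) * u 2 + 0" if "u \<in> jets I" for u
    using g21[OF that] by simp
  have g31': "g 3 1 u = \<epsilon> * u 0 + (- \<epsilon> * lam) * u 2 + 0" if "u \<in> jets I" for u
    unfolding g31[OF that] g21[OF that] by (simp add: algebra_simps)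
  have g32': "g 3 2 u = \<epsilon> * \<psi> u" if "u \<in> jets I" for u
    using g32[OF that] g22[OF that] by simp
  have jet: "jet_smooth I 2 (g i j)" if "i \<in> {1..3}" "j \<in> {1..2}" for i j
  proof -
    have "i = 1 \<or> i = 2 \<or> i = 3" "j = 1 \<or> j = 2"
      using that by auto
    moreover have "jet_smooth I 2 (g 1 1)" "jet_smooth I 2 (g 1 2)"
      by (simp_all only: jet_smooth_cong[OF I, of "g 1 1", OF g11]
          jet_smooth_cong[OF I, of "g 1 2", OF g12] jet_smooth_const[OF I])
    moreover have "jet_smooth I 2 (g 2 1)" "jet_smooth I 2 (g 3 1)"
      using jet_smooth_cong[OF I, of "g 2 1", OF g21'] jet_smooth_cong[OF I, of "g 3 1", OF g31'] jet_smooth_affine[OF I order_refl] by blast+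
    moreover have "jet_smooth I 2 (g 2 2)" "jet_smooth I 2 (g 3 2)"
      using jet_smooth_cong[OF I, of "g 2 2", OF g22] jet_smooth_cong[OF I, of "g 3 2", OF g32'] \<psi> 
        jet_smooth_mult[OF I jet_smooth_const[OF I] \<psi>] by blast+
    ultimately show ?thesis
      by metis
  qed
  have "third_order_eq lam A B u v \<longleftrightarrow>
    structure_equations 1 (assoc_form g 1) (assoc_form g 2) (assoc_form g 3) u v"
    if u: "u \<in> jets I" for u v
  proof -
    have c: "Dx (g 1 2) u = 0" "Dt (g 1 1) u v = 0"
      using Dx_cong[OF I u, of "g 1 2" "\<lambda>_. \<epsilon> * b"] Dt_cong[OF I u, of "g 1 1" "\<lambda>_. - \<epsilon> * a"]
        g12 g11 Dx_const Dt_const by simp_all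
    have Dt: "Dt (g 2 1) u v = v 0 - lam * v 2" "Dt (g 3 1) u v = \<epsilon> * (v 0 - lam * v 2)"
      using Dt_affine[OF I u g21'] Dt_affine[OF I u g31'] by (simp_all add: algebra_simps)
    have Dx: "Dx (g 2 2) u = Dx \<psi> u" "Dx (g 3 2) u = \<epsilon> * Dx \<psi> u"
      using Dx_cong[OF I u, of "g 2 2", OF g22] Dx_cong[OF I u, of "g 3 2", OF g32']
        Dx_mult[OF I u finite_order_const[OF I] finite_orderI[OF \<psi>]]
      by (simp_all add: Dx_const)
    show ?thesis
      unfolding structure_equations_iff third_order_eq_def eq[OF u] c Dt Dx
        g11[OF u] g12[OF u] g31[OF u] g32[OF u] g21[OF u] g22[OF u]
      using \<epsilon> by (auto simp: algebra_simps)
  qed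
  moreover have "generically_nonzero I (wedge (assoc_form g 1) (assoc_form g 2))"
  proof (rule generically_nonzero_cong[OF _ gen])
    fix u assume u: "u \<in> jets I" "a * \<psi> u + b * (u 0 - lam * u 2) \<noteq> 0"
    have "wedge (assoc_form g 1) (assoc_form g 2) u = - \<epsilon> * (a * \<psi> u + b * (u 0 - lam * u 2))"
      unfolding wedge_def assoc_form_def fst_conv snd_conv
        g11[OF u(1)] g12[OF u(1)] g21[OF u(1)] g22[OF u(1)]
      by (simp add: algebra_simps)
    then show "wedge (assoc_form g 1) (assoc_form g 2) u \<noteq> 0"
      using u \<epsilon> by auto
  qed
  moreover have "admissible I 1 g"
    unfolding admissible_def constant_on_jets_def affine_in_z_z2_def
  proof (intro conjI ballI)
    fix u assume u: "u \<in> jets I"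
    have "pd 0 (g 2 1) u = 1" "pd 0 (g 3 1) u = \<epsilon>"
      using pd_affine_cong[OF I u, of "g 2 1", OF g21', of 0]
        pd_affine_cong[OF I u, of "g 3 1", OF g31', of 0] by simp_all
    then show "(pd 0 (g 3 1) u)\<^sup>2 - 1 * (pd 0 (g 2 1) u)\<^sup>2 = 0"
      using \<epsilon>2 by (simp add: power2_eq_square)
  qed (use g11 g21' g31' in blast)+
  ultimately show ?thesis
    unfolding describes_def using jet by blast
qed

section \<open>Form (II): nondegeneracy and structure equations\<close>

lemma Dx_order_0:
  assumes I: "jet_domain I" and h: "jet_smooth I 0 h" and u: "u \<in> jets I"
  shows "Dx h u = u 1 * pd 0 h u"
  using Dx_eq_sum[OF I h u] by simp

lemma Dx_Dx_order_0:
  assumes I: "jet_domain I" and h: "jet_smooth I 0 h" and u: "u \<in> jets I"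
  shows "Dx (Dx h) u = u 2 * pd 0 h u + (u 1)\<^sup>2 * pd 0 (pd 0 h) u"
proof -
  have "Dx (Dx h) u = Dx (\<lambda>u. u 1 * pd 0 h u) u"
    by (rule Dx_cong[OF I u Dx_order_0[OF I h]])
  also have "\<dots> = Dx (\<lambda>u. u 1) u * pd 0 h u + u 1 * Dx (pd 0 h) u"
    by (intro Dx_mult[OF I u] finite_order_coord I finite_orderI[OF jet_smooth_pd[OF I h]])
  finally show ?thesis
    using Dx_order_0[OF I jet_smooth_pd[OF I h] u, of 0]
    by (simp add: Dx_coord numeral_2_eq_2 power2_eq_square)
qed

text \<open>\<open>W\<close> is the coefficient of \<open>\<omega>1 \<and> \<omega>2\<close>. By the
  formulas for \<open>D_x h\<close> and \<open>D_x D_x h\<close>, \<open>\<alpha> W\<close> is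
  affine in \<open>z_2\<close> with coefficient
  \<open>- \<epsilon> h_{,z} (\<eta> + \<lambda> z_1)\<close>. If \<open>W\<close> vanished
  identically, comparing two values of \<open>z_2\<close> where \<open>h_{,z} \<noteq> 0\<close>
  would give \<open>\<eta> + \<lambda> z_1 = 0\<close>, and varying \<open>z_1\<close> would then
  give \<open>\<lambda> = \<eta> = 0\<close>.\<close>

lemma form_II_wedge_nonzero:
  fixes h :: jetfun and \<epsilon> \<eta> \<alpha> lam :: real
  assumes I: "jet_domain I" and h: "jet_smooth I 0 h" and h': "generically_nonzero I (pd 0 h)"
    and \<epsilon>: "\<epsilon> \<in> {1, -1}" and \<alpha>: "\<alpha> \<noteq> 0"
    and W: "\<And>u. u \<in> jets I \<Longrightarrow> W u = (1 / \<alpha>) * (- \<epsilon> * \<eta> * Dx (Dx h) u - \<eta>\<^sup>2 * Dx h u +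
      \<epsilon> * Dx h u * (u 0 - lam * u 2 + \<epsilon> * \<eta>\<^sup>2 / 2 - \<epsilon> * \<alpha>\<^sup>2 / 2))"
  obtains u where "u \<in> jets I" "W u \<noteq> 0"
proof (rule ccontr)
  assume "\<not> thesis"
  then have W0: "W u = 0" if "u \<in> jets I" for u
    using that \<open>\<And>u. u \<in> jets I \<Longrightarrow> W u \<noteq> 0 \<Longrightarrow> thesis\<close> by blast
  obtain J where J: "jet_domain J" "\<forall>i. J i \<subseteq> I i" and h'0: "\<And>u. u \<in> jets J \<Longrightarrow> pd 0 h u \<noteq> 0"
    using h' by (auto simp: generically_nonzero_def)
  have JI: "u \<in> jets I" if "u \<in> jets J" for u
    using that J by (auto simp: jets_def)
  have eq: "- \<epsilon> * \<eta> * (u 2 * pd 0 h u + (u 1)\<^sup>2 * pd 0 (pd 0 h) u) - \<eta>\<^sup>2 * (u 1 * pd 0 h u) +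
      \<epsilon> * (u 1 * pd 0 h u) * (u 0 - lam * u 2 + \<epsilon> * \<eta>\<^sup>2 / 2 - \<epsilon> * \<alpha>\<^sup>2 / 2) = 0"
    if "u \<in> jets J" for u
    using W0[OF JI[OF that]] \<alpha> unfolding W[OF JI[OF that]]
    by (simp add: Dx_Dx_order_0[OF I h JI[OF that]] Dx_order_0[OF I h JI[OF that]])
  have pd_upd: "pd 0 F (u(Suc i := s)) = pd 0 F u"
    if "u \<in> jets J" "s \<in> J (Suc i)" "jet_smooth I 0 F" for F u s i
    using that depends_upto_pd[OF I, of 0 F 0]
    by (intro depends_uptoD[of I 0 "pd 0 F"] JI jets_upd) (auto simp: jet_smooth_iff)
  have coeff: "\<eta> + lam * u 1 = 0" if u: "u \<in> jets J" for u
  proof -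
    obtain s where s: "s \<in> J 2" "s \<noteq> u 2"
      using jet_domain_other[OF J(1) jetsD[OF u, of 2]] .
    have u': "u(2 := s) \<in> jets J"
      using u s by (intro jets_upd)
    have "pd 0 h (u(2 := s)) = pd 0 h u" "pd 0 (pd 0 h) (u(2 := s)) = pd 0 (pd 0 h) u"
      using pd_upd[OF u, of s 1] s h jet_smooth_pd[OF I h] by (auto simp: numeral_2_eq_2)
    with eq[OF u] eq[OF u'] have "\<epsilon> * (s - u 2) * pd 0 h u * (\<eta> + lam * u 1) = 0"
      by simp algebra
    then show ?thesis
      using s h'0[OF u] \<epsilon> by auto
  qed
  obtain u0 where u0: "u0 \<in> jets J"
    using jets_nonempty[OF J(1)] by blast
  obtain s where s: "s \<in> J 1" "s \<noteq> u0 1"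
    using jet_domain_other[OF J(1) jetsD[OF u0, of 1]] .
  have u1: "u0(1 := s) \<in> jets J"
    using u0 s by (intro jets_upd)
  have "lam * s = lam * u0 1"
    using coeff[OF u0] coeff[OF u1] by (metis add_left_cancel fun_upd_same)
  then have lam: "lam = 0"
    using s by simp
  then have \<eta>: "\<eta> = 0"
    using coeff[OF u0] by simp
  obtain u where u: "u \<in> jets J" "u 1 \<noteq> 0"
    using u0 u1 s by (metis fun_upd_same)
  \<comment> \<open>With \<open>\<lambda> = \<eta> = 0\<close> only
    \<open>\<epsilon> z_1 h_{,z} (z - \<epsilon> \<alpha>^2 / 2)\<close> is left, which cannot
    vanish for all \<open>z\<close> in an interval.\<close>
  have z: "u 0 = \<epsilon> * \<alpha>\<^sup>2 / 2" if "u \<in> jets J" "u 1 \<noteq> 0" for u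
    using eq[OF that(1)] that h'0[OF that(1)] \<epsilon> by (simp add: lam \<eta>) auto
  obtain t where t: "t \<in> J 0" "t \<noteq> u 0"
    using jet_domain_other[OF J(1) jetsD[OF u(1), of 0]] .
  have "u(0 := t) \<in> jets J"
    using u t by (intro jets_upd)
  from z[OF this] z[OF u] u(2) t show False
    by simp
qed

lemma form_II_describes:
  assumes I: "jet_domain I" and form: "form_II I lam A B g"
  shows "describes I 1 (third_order_eq lam A B) g \<and> admissible I 1 g"
proof -
  obtain \<epsilon> \<eta> \<alpha> :: real and h where \<epsilon>: "\<epsilon> \<in> {1, -1}" and h: "jet_smooth I 0 h"
    and h': "generically_nonzero I (pd 0 h)" and \<alpha>: "\<alpha> \<noteq> 0"
    and eq: "\<And>u. u \<in> jets I \<Longrightarrow> A u * u 3 + B u =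
      - \<epsilon> * Dx (Dx (Dx h)) u - Dx (\<lambda>u. (u 0 - lam * u 2) * h u) u - (u 0 - lam * u 2) * Dx h u"
    and g11: "\<And>u. u \<in> jets I \<Longrightarrow> g 1 1 u = \<eta>"
    and g12: "\<And>u. u \<in> jets I \<Longrightarrow> g 1 2 u = - \<epsilon> * Dx h u - \<eta> * h u"
    and g21: "\<And>u. u \<in> jets I \<Longrightarrow> g 2 1 u = 1 / \<alpha> * (u 0 - lam * u 2 + \<epsilon> * \<eta>\<^sup>2 / 2 - \<epsilon> * \<alpha>\<^sup>2 / 2)"
    and g22: "\<And>u. u \<in> jets I \<Longrightarrow> g 2 2 u = 1 / \<alpha> * (- \<epsilon> * Dx (Dx h) u - \<eta> * Dx h u -
      (u 0 - lam * u 2 + \<epsilon> * \<eta>\<^sup>2 / 2 - \<epsilon> * \<alpha>\<^sup>2 / 2) * h u)"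
    and g31: "\<And>u. u \<in> jets I \<Longrightarrow> g 3 1 u = \<epsilon> * g 2 1 u + \<alpha>"
    and g32: "\<And>u. u \<in> jets I \<Longrightarrow> g 3 2 u = \<epsilon> * g 2 2 u - \<alpha> * h u"
    using form unfolding form_II_def Let_def by blast
  define \<kappa> where "\<kappa> = \<epsilon> * \<eta>\<^sup>2 / 2 - \<epsilon> * \<alpha>\<^sup>2 / 2"
  have h0: "finite_order I h"
    using h by (rule finite_orderI)
  note fo = finite_order_intros[OF I] h0
  have g21': "g 2 1 u = 1 / \<alpha> * u 0 + (- lam / \<alpha>) * u 2 + \<kappa> / \<alpha>" if "u \<in> jets I" for u
    unfolding g21[OF that] \<kappa>_def using \<alpha> by (simp add: field_simps)
  have g31': "g 3 1 u = \<epsilon> / \<alpha> * u 0 + (- \<epsilon> * lam / \<alpha>) * u 2 + (\<epsilon> * \<kappa> / \<alpha> + \<alpha>)" if "u \<in> jets I" for u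
    unfolding g31[OF that] g21'[OF that] using \<alpha> by (simp add: field_simps)
  have g22': "g 2 2 u = 1 / \<alpha> * (- \<epsilon> * Dx (Dx h) u - \<eta> * Dx h u - (u 0 - lam * u 2 + \<kappa>) * h u)"
    if "u \<in> jets I" for u
    using g22[OF that] by (simp add: \<kappa>_def)
  have g32': "g 3 2 u = \<epsilon> * (1 / \<alpha> * (- \<epsilon> * Dx (Dx h) u - \<eta> * Dx h u - (u 0 - lam * u 2 + \<kappa>) * h u)) - \<alpha> * h u"
    if "u \<in> jets I" for u
    using g32[OF that] g22'[OF that] by simp
  have h2: "jet_smooth I 2 h" "jet_smooth I 2 (Dx h)" "jet_smooth I 2 (Dx (Dx h))"
    using jet_smooth_mono[OF h] jet_smooth_mono[OF jet_smooth_Dx[OF I h]]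
      jet_smooth_mono[OF jet_smooth_Dx[OF I jet_smooth_Dx[OF I h]]] by simp_all
  have jet: "jet_smooth I 2 (g i j)" if "i \<in> {1..3}" "j \<in> {1..2}" for i j
  proof -
    have "i = 1 \<or> i = 2 \<or> i = 3" "j = 1 \<or> j = 2"
      using that by auto
    moreover have "jet_smooth I 2 (g 1 1)"
      by (simp only: jet_smooth_cong[OF I, of "g 1 1", OF g11] jet_smooth_const[OF I])
    moreover have "jet_smooth I 2 (g 2 1)" "jet_smooth I 2 (g 3 1)"
      using jet_smooth_cong[OF I, of "g 2 1", OF g21'] jet_smooth_cong[OF I, of "g 3 1", OF g31'] jet_smooth_affine[OF I order_refl] by blast+
    moreover have "jet_smooth I 2 (\<lambda>u. - \<epsilon> * Dx h u - \<eta> * h u)"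
      by (intro jet_smooth_intros I h2)
    then have "jet_smooth I 2 (g 1 2)"
      using jet_smooth_cong[OF I, of "g 1 2", OF g12] by blast
    moreover have "jet_smooth I 2 (\<lambda>u. 1 / \<alpha> * (- \<epsilon> * Dx (Dx h) u - \<eta> * Dx h u - (u 0 - lam * u 2 + \<kappa>) * h u))"
      by (intro jet_smooth_intros I h2) auto
    then have "jet_smooth I 2 (g 2 2)"
      using jet_smooth_cong[OF I, of "g 2 2", OF g22'] by blast
    moreover have "jet_smooth I 2 (\<lambda>u. \<epsilon> * (1 / \<alpha> * (- \<epsilon> * Dx (Dx h) u - \<eta> * Dx h u - (u 0 - lam * u 2 + \<kappa>) * h u)) - \<alpha> * h u)"
      by (intro jet_smooth_intros I h2) auto
    then have "jet_smooth I 2 (g 3 2)"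
      using jet_smooth_cong[OF I, of "g 3 2", OF g32'] by blast
    ultimately show ?thesis
      by metis
  qed
  have "third_order_eq lam A B u v \<longleftrightarrow>
    structure_equations 1 (assoc_form g 1) (assoc_form g 2) (assoc_form g 3) u v"
    if u: "u \<in> jets I" for u v
  proof -
    note simps = Dx_simps(1,2) Dx_simps(3-7)[OF I u] fo numeral_2_eq_2 numeral_3_eq_3
    define w w' m where "w = u 0 - lam * u 2" and "w' = u 1 - lam * u 3" and "m = w + \<kappa>"
    have g: "g 1 1 u = \<eta>" "g 1 2 u = - \<epsilon> * Dx h u - \<eta> * h u" "g 2 1 u = m / \<alpha>"
      "g 2 2 u = (- \<epsilon> * Dx (Dx h) u - \<eta> * Dx h u - m * h u) / \<alpha>"
      "g 3 1 u = \<epsilon> * (m / \<alpha>) + \<alpha>"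
      "g 3 2 u = \<epsilon> * ((- \<epsilon> * Dx (Dx h) u - \<eta> * Dx h u - m * h u) / \<alpha>) - \<alpha> * h u"
      using g11[OF u] g12[OF u] g21[OF u] g22'[OF u] g31[OF u] g32'[OF u]
      by (simp_all add: m_def w_def \<kappa>_def add_diff_eq)
    have Dt: "Dt (g 1 1) u v = 0" "Dt (g 2 1) u v = (v 0 - lam * v 2) / \<alpha>"
      "Dt (g 3 1) u v = \<epsilon> * ((v 0 - lam * v 2) / \<alpha>)"
      using Dt_cong[OF I u, of "g 1 1", OF g11] Dt_const Dt_affine[OF I u g21'] Dt_affine[OF I u g31'] \<alpha>
      by (simp_all add: field_simps)
    have D12: "Dx (g 1 2) u = - \<epsilon> * Dx (Dx h) u - \<eta> * Dx h u"
      using Dx_cong[OF I u, of "g 1 2", OF g12] by (simp add: simps)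
    have D22: "Dx (g 2 2) u =
        (- \<epsilon> * Dx (Dx (Dx h)) u - \<eta> * Dx (Dx h) u - w' * h u - m * Dx h u) / \<alpha>"
      using Dx_cong[OF I u, of "g 2 2", OF g22'] \<alpha>
      by (simp add: simps) (simp add: w_def w'_def m_def numeral_2_eq_2 numeral_3_eq_3 field_simps)
    have D32: "Dx (g 3 2) u =
        \<epsilon> * ((- \<epsilon> * Dx (Dx (Dx h)) u - \<eta> * Dx (Dx h) u - w' * h u - m * Dx h u) / \<alpha>) - \<alpha> * Dx h u"
      using Dx_cong[OF I u, of "g 3 2", OF g32'] \<alpha>
      by (simp add: simps) (simp add: w_def w'_def m_def numeral_2_eq_2 numeral_3_eq_3 field_simps)
    have G: "A u * u 3 + B u = - \<epsilon> * Dx (Dx (Dx h)) u - w' * h u - 2 * w * Dx h u"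
      unfolding eq[OF u] by (simp add: simps)
        (simp add: w_def w'_def numeral_2_eq_2 numeral_3_eq_3 algebra_simps)
    \<comment> \<open>The first structure equation holds identically; the other two are the PDE with
      the nonzero factors \<open>1 / \<alpha>\<close> and
      \<open>\<epsilon> / \<alpha>\<close>.\<close>
    have 1: "Dx (g 1 2) u = g 3 1 u * g 2 2 u - g 3 2 u * g 2 1 u"
      unfolding g D12 using \<alpha> by (simp add: field_simps)
    \<comment> \<open>After multiplication by \<open>\<alpha>\<close>, the two products contribute
      \<open>(2 * \<kappa> - m) * Dx h u\<close>. Together with \<open>- m * Dx h u\<close> from
      \<open>D22\<close> this leaves \<open>- 2 * w * Dx h u\<close>.\<close>
    have 2: "Dx (g 2 2) u - (g 1 1 u * g 3 2 u - g 1 2 u * g 3 1 u) = (A u * u 3 + B u) / \<alpha>"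
      unfolding g D22 G using \<alpha> \<epsilon> by (auto simp: m_def \<kappa>_def field_simps power2_eq_square)
    have 3: "Dx (g 3 2) u - (g 1 1 u * g 2 2 u - g 1 2 u * g 2 1 u) = \<epsilon> * ((A u * u 3 + B u) / \<alpha>)"
      unfolding g D32 G using \<alpha> \<epsilon> by (auto simp: m_def \<kappa>_def field_simps power2_eq_square)
    have "structure_equations 1 (assoc_form g 1) (assoc_form g 2) (assoc_form g 3) u v \<longleftrightarrow>
      Dx (g 2 2) u - (g 1 1 u * g 3 2 u - g 1 2 u * g 3 1 u) = (v 0 - lam * v 2) / \<alpha> \<and>
      Dx (g 3 2) u - (g 1 1 u * g 2 2 u - g 1 2 u * g 2 1 u) = \<epsilon> * ((v 0 - lam * v 2) / \<alpha>)"
      unfolding structure_equations_iff Dt using 1 by auto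
    then show ?thesis
      unfolding 2 3 using \<alpha> by (auto simp: third_order_eq_def)
  qed
  moreover have "generically_nonzero I (wedge (assoc_form g 1) (assoc_form g 2))"
  proof -
    have W: "wedge (assoc_form g 1) (assoc_form g 2) u = (1 / \<alpha>) * (- \<epsilon> * \<eta> * Dx (Dx h) u - \<eta>\<^sup>2 * Dx h u +
      \<epsilon> * Dx h u * (u 0 - lam * u 2 + \<epsilon> * \<eta>\<^sup>2 / 2 - \<epsilon> * \<alpha>\<^sup>2 / 2))" if "u \<in> jets I" for u
      unfolding wedge_def assoc_form_def fst_conv snd_conv
        g11[OF that] g12[OF that] g21[OF that] g22[OF that]
      using \<alpha> by (simp add: field_simps power2_eq_square)
    obtain u where u: "u \<in> jets I" "wedge (assoc_form g 1) (assoc_form g 2) u \<noteq> 0"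
      by (rule form_II_wedge_nonzero[OF I h h' \<epsilon> \<alpha> W])
    have "jet_smooth I 2 (\<lambda>u. g 1 1 u * g 2 2 u - g 1 2 u * g 2 1 u)"
      using jet by (intro jet_smooth_intros I) auto
    then have "continuous_on (jets I) (wedge (assoc_form g 1) (assoc_form g 2))"
      by (auto simp: jet_smooth_iff wedge_def assoc_form_def[abs_def] dest: smooth_on_jets_continuous)
    then show ?thesis
      using generically_nonzeroI[OF I] u by blast
  qed
  moreover have "admissible I 1 g"
    unfolding admissible_def constant_on_jets_def affine_in_z_z2_def
  proof (intro conjI ballI)
    fix u assume u: "u \<in> jets I"
    have "pd 0 (g 2 1) u = 1 / \<alpha>" "pd 0 (g 3 1) u = \<epsilon> / \<alpha>"
      using pd_affine_cong[OF I u, of "g 2 1", OF g21', of 0]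
        pd_affine_cong[OF I u, of "g 3 1", OF g31', of 0] by simp_all
    then show "(pd 0 (g 3 1) u)\<^sup>2 - 1 * (pd 0 (g 2 1) u)\<^sup>2 = 0"
      using \<epsilon> by (auto simp: power2_eq_square)
  qed (use g11 g21' g31' in blast)+
  ultimately show ?thesis
    unfolding describes_def using jet by blast
qed

section \<open>Classification\<close>

text \<open>At a fixed jet \<open>u\<close> the t-derivatives \<open>v\<close> are free, and the
  equation cuts out the line \<open>v 0 - lam * v 2 = G\<close> in the plane of
  \<open>(v 0, v 2)\<close>. The structure equations, which are affine in \<open>v 0\<close> and
  \<open>v 2\<close>, must cut out exactly this line.\<close>

lemma describes_affine_coefficients:
  assumes I: "jet_domain I" and \<delta>: "\<delta> \<in> {1, -1}"
    and D: "describes I \<delta> (third_order_eq lam A B) f" and adm: "admissible I \<delta> f"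
  obtains \<epsilon> \<eta> p \<rho> \<sigma> where "\<delta> = 1" "\<epsilon> \<in> {1, -1}" "p \<noteq> 0"
    "\<And>u. u \<in> jets I \<Longrightarrow> f 1 1 u = \<eta>"
    "\<And>u. u \<in> jets I \<Longrightarrow> f 2 1 u = p * (u 0 - lam * u 2) + \<rho>"
    "\<And>u. u \<in> jets I \<Longrightarrow> f 3 1 u = \<epsilon> * p * (u 0 - lam * u 2) + \<sigma>"
proof -
  obtain \<eta> where f11: "\<forall>u\<in>jets I. f 1 1 u = \<eta>"
    using adm unfolding admissible_def constant_on_jets_def by blast
  obtain p2 q2 \<rho> where f21: "\<And>u. u \<in> jets I \<Longrightarrow> f 2 1 u = p2 * u 0 + q2 * u 2 + \<rho>"
    using adm unfolding admissible_def affine_in_z_z2_def by blast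
  obtain p3 q3 \<sigma> where f31: "\<And>u. u \<in> jets I \<Longrightarrow> f 3 1 u = p3 * u 0 + q3 * u 2 + \<sigma>"
    using adm unfolding admissible_def affine_in_z_z2_def by blast
  obtain u where u: "u \<in> jets I"
    using jets_nonempty[OF I] by blast
  define G where "G = A u * u 3 + B u"
  have E: "v 0 - lam * v 2 = G \<longleftrightarrow>
     Dx (f 1 2) u - Dt (f 1 1) u v = f 3 1 u * f 2 2 u - f 3 2 u * f 2 1 u \<and>
     Dx (f 2 2) u - (p2 * v 0 + q2 * v 2) = f 1 1 u * f 3 2 u - f 1 2 u * f 3 1 u \<and>
     Dx (f 3 2) u - (p3 * v 0 + q3 * v 2) = \<delta> * (f 1 1 u * f 2 2 u - f 1 2 u * f 2 1 u)" for v
  proof -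
    have Dt: "Dt (f 2 1) u v = p2 * v 0 + q2 * v 2" "Dt (f 3 1) u v = p3 * v 0 + q3 * v 2"
      by (rule Dt_affine[OF I u f21], assumption, rule Dt_affine[OF I u f31])
    have "third_order_eq lam A B u v \<longleftrightarrow>
        structure_equations \<delta> (assoc_form f 1) (assoc_form f 2) (assoc_form f 3) u v"
      using D u unfolding describes_def by blast
    then show ?thesis
      unfolding third_order_eq_def structure_equations_iff Dt G_def .
  qed
  have Dt0: "Dt (f 1 1) u v = 0" for v
    using Dt_cong[OF I u, of "f 1 1" "\<lambda>_. \<eta>"] f11 Dt_const by simp
  define v :: "real \<Rightarrow> real \<Rightarrow> jet" where "v x y = (\<lambda>i. if i = 0 then x else y)" for x y
  have v: "v x y 0 = x" "v x y 2 = y" for x y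
    by (simp_all add: v_def)
  note E' = E[of "v _ _", unfolded v Dt0]
  \<comment> \<open>The points \<open>(G, 0)\<close> and \<open>(G + lam, 1)\<close> both lie on the
    line, so the linear parts vanish on their difference \<open>(lam, 1)\<close>.\<close>
  have q: "q2 = - lam * p2" "q3 = - lam * p3"
    using E'[of G 0] E'[of "G + lam" 1] by (auto simp: algebra_simps)
  \<comment> \<open>The point \<open>(G + 1, 0)\<close> is off the line, so some structure equation
    must fail there; with \<open>p2 = p3 = 0\<close> none of them would depend on
    \<open>v\<close>.\<close>
  have p: "p2 \<noteq> 0 \<or> p3 \<noteq> 0"
    using E'[of G 0] E'[of "G + 1" 0] by (auto simp: algebra_simps)
  have "(pd 0 (f 3 1) u)\<^sup>2 - \<delta> * (pd 0 (f 2 1) u)\<^sup>2 = 0"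
    using adm u unfolding admissible_def by blast
  then have p23: "p3\<^sup>2 = \<delta> * p2\<^sup>2"
    using pd_affine_cong[OF I u, of "f 2 1", OF f21, of 0]
      pd_affine_cong[OF I u, of "f 3 1", OF f31, of 0] by simp
  \<comment> \<open>For \<open>\<delta> = - 1\<close> the condition would be a vanishing sum of two
    real squares.\<close>
  have \<delta>1: "\<delta> = 1"
  proof (rule ccontr)
    assume "\<delta> \<noteq> 1"
    then have "p3\<^sup>2 + p2\<^sup>2 = 0"
      using \<delta> p23 by simp
    then show False
      using p by (simp add: sum_power2_eq_zero_iff)
  qed
  then have "p3 = 1 * p2 \<or> p3 = - 1 * p2"
    using p23 by (auto simp: power2_eq_iff)
  then obtain \<epsilon> where \<epsilon>: "\<epsilon> \<in> {1, -1}" "p3 = \<epsilon> * p2"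
    by blast
  show ?thesis
  proof (rule that[OF \<delta>1 \<epsilon>(1)])
    show "p2 \<noteq> 0"
      using p \<epsilon> by auto
    show "f 1 1 u = \<eta>" if "u \<in> jets I" for u
      using f11 that by blast
    show "f 2 1 u = p2 * (u 0 - lam * u 2) + \<rho>" if "u \<in> jets I" for u
      unfolding f21[OF that] q by (simp add: algebra_simps)
    show "f 3 1 u = \<epsilon> * p2 * (u 0 - lam * u 2) + \<sigma>" if "u \<in> jets I" for u
      unfolding f31[OF that] q \<epsilon>(2) by (simp add: algebra_simps)
  qed
qed

section \<open>Consequences of the structure equations for coefficients affine in w\<close>

context
  fixes I lam A B f and \<epsilon> \<eta> p \<rho> \<sigma> :: real
  assumes I: "jet_domain I" and A: "jet_smooth I 2 A" and B: "jet_smooth I 2 B"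
    and D: "describes I 1 (third_order_eq lam A B) f"
    and \<epsilon>: "\<epsilon> \<in> {1, -1}" and p: "p \<noteq> 0"
    and f11: "\<And>u. u \<in> jets I \<Longrightarrow> f 1 1 u = \<eta>"
    and f21: "\<And>u. u \<in> jets I \<Longrightarrow> f 2 1 u = p * (u 0 - lam * u 2) + \<rho>"
    and f31: "\<And>u. u \<in> jets I \<Longrightarrow> f 3 1 u = \<epsilon> * p * (u 0 - lam * u 2) + \<sigma>"
begin

lemma structure_equations_explicit:
  assumes u: "u \<in> jets I"
  shows "Dx (f 1 2) u = f 3 1 u * f 2 2 u - f 3 2 u * f 2 1 u"
    and "Dx (f 2 2) u = p * (A u * u 3 + B u) + \<eta> * f 3 2 u - f 1 2 u * f 3 1 u"
    and "Dx (f 3 2) u = \<epsilon> * p * (A u * u 3 + B u) + \<eta> * f 2 2 u - f 1 2 u * f 2 1 u"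
proof -
  \<comment> \<open>This is one particular solution of the PDE over the jet \<open>u\<close>.
    Inserting it replaces \<open>z_t - \<lambda> z_{2t}\<close> by the right-hand side and leaves
    relations between functions of \<open>u\<close> alone.\<close>
  define v :: jet where "v i = (if i = 0 then A u * u 3 + B u else 0)" for i
  have "third_order_eq lam A B u v"
    by (simp add: third_order_eq_def v_def)
  then have "structure_equations 1 (assoc_form f 1) (assoc_form f 2) (assoc_form f 3) u v"
    using D u unfolding describes_def by blast
  moreover have "Dt (f 1 1) u v = 0"
    using Dt_cong[OF I u, of "f 1 1" "\<lambda>_. \<eta>"] f11 Dt_const by simp
  moreover have "Dt (f 2 1) u v = p * v 0 + - p * lam * v 2"
    by (rule Dt_affine[OF I u, of _ _ _ \<rho>]) (simp add: f21[unfolded One_nat_def] algebra_simps)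
  moreover have "Dt (f 3 1) u v = \<epsilon> * p * v 0 + - \<epsilon> * p * lam * v 2"
    by (rule Dt_affine[OF I u, of _ _ _ \<sigma>]) (simp add: f31[unfolded One_nat_def] algebra_simps)
  ultimately show "Dx (f 1 2) u = f 3 1 u * f 2 2 u - f 3 2 u * f 2 1 u"
    "Dx (f 2 2) u = p * (A u * u 3 + B u) + \<eta> * f 3 2 u - f 1 2 u * f 3 1 u"
    "Dx (f 3 2) u = \<epsilon> * p * (A u * u 3 + B u) + \<eta> * f 2 2 u - f 1 2 u * f 2 1 u"
    unfolding structure_equations_iff f11[OF u] by (simp_all add: v_def)
qed

lemma jet_smooth_f: 
  obtains k where "jet_smooth I k (f 1 2)" "jet_smooth I k (f 2 2)" "jet_smooth I k (f 3 2)"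
proof -
  obtain k where "\<forall>i\<in>{1..3}. \<forall>j\<in>{1..2}. jet_smooth I k (f i j)"
    using D unfolding describes_def by blast
  then show ?thesis
    by (intro that[of k]) auto
qed

lemma depends_upto_rhs: "3 \<le> m \<Longrightarrow> depends_upto I m (\<lambda>u. A u * u 3 + B u)"
  using A B by (intro depends_upto_add depends_upto_mult depends_upto_coord)
    (auto simp: jet_smooth_iff intro: depends_upto_mono)

lemma depends_upto_f21: "2 \<le> m \<Longrightarrow> depends_upto I m (f 2 1)"
   by (rule depends_upto_congI, erule f21, intro depends_upto_intros) auto

lemma depends_upto_f31: "2 \<le> m \<Longrightarrow> depends_upto I m (f 3 1)"
   by (rule depends_upto_congI, erule f31, intro depends_upto_intros) auto

lemma wedge_nonzero: 
  obtains u where "u \<in> jets I" "\<eta> * f 2 2 u - f 1 2 u * f 2 1 u \<noteq> 0"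
proof -
  have "generically_nonzero I (wedge (assoc_form f 1) (assoc_form f 2))"
    using D unfolding describes_def by blast
  then obtain u where "u \<in> jets I" "wedge (assoc_form f 1) (assoc_form f 2) u \<noteq> 0"
    by (rule generically_nonzeroE)
  then show ?thesis
    using that[of u] f11[of u] by (simp add: wedge_def assoc_form_def)
qed

text \<open>
  The right-hand side of the PDE cancels in the equation for \<open>f 3 2 - \<epsilon> f 2 2\<close>.
\<close>

lemma Dx_difference:
  assumes u: "u \<in> jets I"
  shows "Dx (\<lambda>u. f 3 2 u - \<epsilon> * f 2 2 u) u =
    \<epsilon> * ((\<sigma> - \<epsilon> * \<rho>) * f 1 2 u - \<eta> * (f 3 2 u - \<epsilon> * f 2 2 u))"
proof -
  obtain k where k: "jet_smooth I k (f 1 2)" "jet_smooth I k (f 2 2)" "jet_smooth I k (f 3 2)"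
    by (rule jet_smooth_f)
  note fo = finite_order_intros[OF I] k[THEN finite_orderI]
  have "Dx (\<lambda>u. f 3 2 u - \<epsilon> * f 2 2 u) u = Dx (f 3 2) u - \<epsilon> * Dx (f 2 2) u"
    by (simp add: Dx_simps(1) Dx_simps(3-7)[OF I u] fo)
  then show ?thesis
    using \<epsilon> unfolding structure_equations_explicit[OF u] f21[OF u] f31[OF u] by (auto simp: algebra_simps)
qed

lemma constant_f12_if_proportional:
  assumes r: "\<sigma> = \<epsilon> * \<rho>"
  obtains \<mu> where "\<And>u. u \<in> jets I \<Longrightarrow> f 1 2 u = \<mu>" "\<And>u. u \<in> jets I \<Longrightarrow> f 3 2 u = \<epsilon> * f 2 2 u"
proof -
  obtain k where k: "jet_smooth I k (f 1 2)" "jet_smooth I k (f 2 2)" "jet_smooth I k (f 3 2)"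
    by (rule jet_smooth_f)
  note fo = finite_order_intros[OF I] k[THEN finite_orderI]
  define N where "N = (\<lambda>u. f 3 2 u - \<epsilon> * f 2 2 u)"
  have "jet_smooth I k N"
    unfolding N_def by (intro jet_smooth_intros I k)
  moreover have DxN: "Dx N u = - \<epsilon> * \<eta> * N u" if "u \<in> jets I" for u
    using Dx_difference[OF that] by (simp add: N_def r)
  have "depends_upto I m (Dx N)" if "jet_smooth I m N" for m
    
    by (rule depends_upto_congI, erule DxN, intro depends_upto_intros)
      (use that in \<open>simp_all add: jet_smooth_iff\<close>)
  ultimately obtain n where N: "\<forall>u\<in>jets I. N u = n"
    using constant_if_Dx_depends_upto[OF I] by blast
  have Dx12: "Dx (f 1 2) u = - n * f 2 1 u" if u: "u \<in> jets I" for u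
  proof -
    have "f 3 2 u = n + \<epsilon> * f 2 2 u"
      using N u unfolding N_def by force
    then show ?thesis
      unfolding structure_equations_explicit[OF u] f21[OF u] f31[OF u] r by (simp add: algebra_simps)
  qed
  \<comment> \<open>The correction by \<open>z_1\<close> removes \<open>z_2\<close> from \<open>D_x f_{12}\<close>, so that \<open>D_x K\<close> depends on \<open>z\<close> only.\<close>
  define K where "K = (\<lambda>u. f 1 2 u - n * p * lam * u 1)"
  have "jet_smooth I (max k 1) K"
    unfolding K_def by (intro jet_smooth_intros I jet_smooth_mono[OF k(1)]) auto
  moreover have DxK: "Dx K u = - n * (p * u 0 + \<rho>)" if u: "u \<in> jets I" for u
    using Dx12[OF u] unfolding K_def f21[OF u]
    by (simp add: Dx_simps(1,2) Dx_simps(3-7)[OF I u] fo[unfolded One_nat_def])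
      (simp add: numeral_2_eq_2 algebra_simps)
  have "depends_upto I m (Dx K)" for m
     by (rule depends_upto_congI, erule DxK, intro depends_upto_intros) auto
  ultimately obtain \<mu> where K: "\<forall>u\<in>jets I. K u = \<mu>"
    using constant_if_Dx_depends_upto[OF I] by blast
  have DxK0: "Dx K u = 0" if "u \<in> jets I" for u
    using Dx_cong[OF I that, of K "\<lambda>_. \<mu>"] K by (simp add: Dx_const)
  \<comment> \<open>Since \<open>K\<close> is constant, \<open>n (p z + \<rho>) = 0\<close> on a
    whole interval of \<open>z\<close>, while \<open>p \<noteq> 0\<close>.\<close>
  have n: "n = 0"
  proof (rule ccontr)
    assume n: "n \<noteq> 0"
    have z: "p * u 0 = - \<rho>" if "u \<in> jets I" for u
      using DxK[OF that] DxK0[OF that] n by simp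
    obtain u where u: "u \<in> jets I"
      using jets_nonempty[OF I] by blast
    obtain s where s: "s \<in> I 0" "s \<noteq> u 0"
      using jet_domain_other[OF I jetsD[OF u]] by blast
    have "p * s = p * u 0"
      using z[OF jets_upd[OF u s(1)]] z[OF u] by simp
    then show False
      using p s by simp
  qed
  show ?thesis
    using that[of \<mu>] K N unfolding n K_def N_def by simp
qed

lemma form_I_of_describes:
  assumes r: "\<rho> = 0" "\<sigma> = 0" and p1: "p = 1" and a: "a \<in> {0, 1}" and b: "b \<in> {0, 1}"
    and \<eta>: "\<eta> = - \<epsilon> * a" and f12: "\<And>u. u \<in> jets I \<Longrightarrow> f 1 2 u = \<epsilon> * b"
    and f32: "\<And>u. u \<in> jets I \<Longrightarrow> f 3 2 u = \<epsilon> * f 2 2 u"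
  shows "form_I I lam A B f"
proof -
  have \<epsilon>2: "\<epsilon> * \<epsilon> = 1" "\<epsilon> * (\<epsilon> * x) = x" for x
    using \<epsilon> by auto
  obtain k where k: "jet_smooth I k (f 2 2)"
    using jet_smooth_f by blast
  have Dx22: "Dx (f 2 2) u = A u * u 3 + B u - a * f 2 2 u - b * f 2 1 u" if u: "u \<in> jets I" for u
    using structure_equations_explicit(2)[OF u]
    unfolding f12[OF u] f32[OF u] f31[OF u] f21[OF u] p1 r \<eta> by (simp add: \<epsilon>2 algebra_simps)
  \<comment> \<open>The right-hand side of the PDE involves \<open>z_3\<close>, so the descent for
    \<open>f_{22}\<close> works at orders above two and ends with \<open>\<psi>\<close> of order
    two.\<close>
  have "depends_upto I m (Dx (f 2 2))" if "2 < m" "jet_smooth I m (f 2 2)" for m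
     by (rule depends_upto_congI, erule Dx22, intro depends_upto_diff depends_upto_rhs
        depends_upto_mult depends_upto_const depends_upto_f21)
      (use that in \<open>auto simp: jet_smooth_iff\<close>)
  then have \<psi>: "jet_smooth I 2 (f 2 2)"
    using jet_smooth_reduce_Dx_upto[OF I k] by blast
  obtain u where u: "u \<in> jets I" "\<eta> * f 2 2 u - f 1 2 u * f 2 1 u \<noteq> 0"
    by (rule wedge_nonzero)
  \<comment> \<open>For \<open>a = b = 0\<close> the form \<open>\<omega>1\<close> would vanish,
    against \<open>\<omega>1 \<and> \<omega>2 \<noteq> 0\<close>.\<close>
  have ab: "a\<^sup>2 + b\<^sup>2 \<noteq> 0"
  proof
    assume "a\<^sup>2 + b\<^sup>2 = 0"
    then have "a = 0" "b = 0"
      by (auto simp: sum_power2_eq_zero_iff)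
    with u f12[OF u(1)] show False
      by (simp add: \<eta>)
  qed
  have gen: "generically_nonzero I (\<lambda>u. a * f 2 2 u + b * (u 0 - lam * u 2))"
  proof (rule generically_nonzeroI[of I _ u, OF I _ u(1)])
    have "jet_smooth I 2 (\<lambda>u. a * f 2 2 u + b * (u 0 - lam * u 2))"
      by (intro jet_smooth_intros I \<psi>) auto
    then show "continuous_on (jets I) (\<lambda>u. a * f 2 2 u + b * (u 0 - lam * u 2))"
      by (simp add: jet_smooth_iff smooth_on_jets_continuous)
    have "\<eta> * f 2 2 u - f 1 2 u * f 2 1 u = - \<epsilon> * (a * f 2 2 u + b * (u 0 - lam * u 2))"
      unfolding f12[OF u(1)] f21[OF u(1)] by (simp add: \<eta> r p1 algebra_simps)
    then show "a * f 2 2 u + b * (u 0 - lam * u 2) \<noteq> 0"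
      using u(2) by auto
  qed
  show ?thesis
    unfolding form_I_def Let_def
  proof (rule bexI[OF _ \<epsilon>], rule bexI[OF _ a], rule bexI[OF _ b], rule exI[of _ "f 2 2"],
      intro conjI ballI)
    fix u assume u: "u \<in> jets I"
    show "A u * u 3 + B u = Dx (f 2 2) u + a * f 2 2 u + b * (u 0 - lam * u 2)"
      using Dx22[OF u] f21[OF u] by (simp add: r p1)
    show "f 3 1 u = \<epsilon> * f 2 1 u" "f 2 1 u = u 0 - lam * u 2"
      using f31[OF u] f21[OF u] by (simp_all add: r p1)
    show "f 1 1 u = - \<epsilon> * a"
      using f11[OF u] \<eta> by simp
  qed (use \<psi> ab gen f12 f32 in auto)
qed

text \<open>The hypotheses describe the situation after normalisation: \<open>\<alpha>\<close> is
  the constant \<open>L\<close>, and the value of \<open>\<rho>\<close> is the one for which the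
  constant multiples of \<open>D_x h\<close> in the PDE cancel.\<close>

lemma form_II_of_describes:
  assumes \<alpha>: "\<alpha> \<noteq> 0" and p\<alpha>: "p = 1 / \<alpha>" and \<rho>: "\<rho> = \<epsilon> * (\<eta>\<^sup>2 - \<alpha>\<^sup>2) / (2 * \<alpha>)"
    and \<sigma>: "\<sigma> = \<epsilon> * \<rho> + \<alpha>"
  shows "form_II I lam A B f"
proof -
  obtain k where k: "jet_smooth I k (f 1 2)" "jet_smooth I k (f 2 2)" "jet_smooth I k (f 3 2)"
    by (rule jet_smooth_f)
  have \<epsilon>2: "\<epsilon> * \<epsilon> = 1" "\<epsilon> * (\<epsilon> * x) = x" for x
    using \<epsilon> by auto
  define h where "h = (\<lambda>u. - 1 / \<alpha> * (f 3 2 u - \<epsilon> * f 2 2 u))"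
  have hk: "jet_smooth I k h"
    unfolding h_def by (intro jet_smooth_intros I k)
  note fo = finite_order_intros[OF I] k[THEN finite_orderI] hk[THEN finite_orderI]
  note simps = Dx_simps(1,2) Dx_simps(3-7)[OF I] fo
  have f32: "f 3 2 u = \<epsilon> * f 2 2 u - \<alpha> * h u" for u
    using \<alpha> by (simp add: h_def)
  have f12: "f 1 2 u = - \<epsilon> * Dx h u - \<eta> * h u" if u: "u \<in> jets I" for u
  proof -
    have "Dx h u = - 1 / \<alpha> * Dx (\<lambda>u. f 3 2 u - \<epsilon> * f 2 2 u) u"
      unfolding h_def by (simp add: simps u)
    also have "\<dots> = - \<epsilon> * f 1 2 u - \<epsilon> * \<eta> * h u"
      unfolding Dx_difference[OF u] \<sigma> using \<alpha> by (simp add: h_def field_simps)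
    finally have "\<epsilon> * Dx h u = \<epsilon> * (- \<epsilon> * f 1 2 u - \<epsilon> * \<eta> * h u)"
      by simp
    then show ?thesis
      by (simp add: \<epsilon>2 algebra_simps)
  qed
  have f22: "f 2 2 u = 1 / \<alpha> * (- \<epsilon> * Dx (Dx h) u - \<eta> * Dx h u) - h u * f 2 1 u" if u: "u \<in> jets I" for u
  proof -
    have "- \<epsilon> * Dx (Dx h) u - \<eta> * Dx h u = Dx (f 1 2) u"
      using Dx_cong[OF I u, of "f 1 2", OF f12] u by (simp add: simps)
    \<comment> \<open>The products \<open>\<epsilon> f_{21} f_{22}\<close> cancel in
      \<open>f_{31} f_{22} - f_{32} f_{21}\<close>, so \<open>f_{22}\<close> occurs with the
      constant coefficient \<open>\<alpha>\<close> and can be solved for.\<close>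
    also have "\<dots> = \<alpha> * (f 2 2 u + h u * f 2 1 u)"
      unfolding structure_equations_explicit[OF u] f32 f31[OF u] f21[OF u] \<sigma> by (simp add: algebra_simps)
    finally show ?thesis
      using \<alpha> by (simp add: field_simps)
  qed
  have "depends_upto I m (Dx h)" if m: "0 < m" and hm: "jet_smooth I m h" for m
  proof -
    have h1: "jet_smooth I (Suc m) (Dx h)" and h2: "jet_smooth I (Suc (Suc m)) (Dx (Dx h))"
      using jet_smooth_Dx[OF I] hm by blast+
    \<comment> \<open>\<open>M\<close> is the order that \<open>D_x D_x h\<close> has a priori. It
      is at least three because \<open>m > 0\<close>, so the right-hand side of the PDE fits into
      order \<open>M\<close> as well.\<close>
    define M where "M = Suc (Suc m)"
    have dep: "depends_upto I M h" "depends_upto I M (Dx h)" "depends_upto I M (Dx (Dx h))"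
      using hm h1 h2 by (auto simp: jet_smooth_iff M_def intro: depends_upto_mono)
    have 21: "depends_upto I M (f 2 1)" "depends_upto I M (f 3 1)"
      using depends_upto_f21 depends_upto_f31 by (simp_all add: M_def)
    have 22: "depends_upto I M (f 2 2)"
       by (rule depends_upto_congI, erule f22, intro depends_upto_intros dep 21)
    have 12: "depends_upto I M (f 1 2)"
       by (rule depends_upto_congI, erule f12, intro depends_upto_intros dep)
    have 32: "depends_upto I M (f 3 2)"
      unfolding f32[abs_def] by (intro depends_upto_intros dep 22)
    have Dx21: "Dx (f 2 1) u = p * (u 1 - lam * u 3)" if u: "u \<in> jets I" for u
      using Dx_cong[OF I u, of "f 2 1", OF f21] by (simp add: simps u numeral_2_eq_2 numeral_3_eq_3)
    have fo21: "finite_order I (f 2 1)"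
      using jet_smooth_cong[where F = "f 2 1", OF I f21, of 2]
      by (intro finite_orderI[of _ 2]) (auto intro!: jet_smooth_intros I)
    have D3: "Dx (Dx (Dx h)) u = - \<epsilon> * \<alpha> * (p * (A u * u 3 + B u) + \<eta> * f 3 2 u - f 1 2 u * f 3 1 u +
        h u * (p * (u 1 - lam * u 3)) + Dx h u * f 2 1 u) - \<epsilon> * \<eta> * Dx (Dx h) u" if u: "u \<in> jets I" for u
    proof -
      have "Dx (f 2 2) u = 1 / \<alpha> * (- \<epsilon> * Dx (Dx (Dx h)) u - \<eta> * Dx (Dx h) u) -
          (Dx h u * f 2 1 u + h u * Dx (f 2 1) u)"
        using Dx_cong[OF I u, of "f 2 2", OF f22] u
        by (simp add: simps fo21[unfolded One_nat_def])
      then have "\<epsilon> * Dx (Dx (Dx h)) u = - \<alpha> * (Dx (f 2 2) u + h u * Dx (f 2 1) u + Dx h u * f 2 1 u)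
          - \<eta> * Dx (Dx h) u"
        using \<alpha> by (simp add: field_simps)
      then have "\<epsilon> * (\<epsilon> * Dx (Dx (Dx h)) u) =
          \<epsilon> * (- \<alpha> * (Dx (f 2 2) u + h u * Dx (f 2 1) u + Dx h u * f 2 1 u) - \<eta> * Dx (Dx h) u)"
        by simp
      then show ?thesis
        unfolding \<epsilon>2 Dx21[OF u] structure_equations_explicit(2)[OF u] by (simp add: algebra_simps)
    qed
    have "depends_upto I M (Dx (Dx (Dx h)))"
       by (rule depends_upto_congI, erule D3, intro depends_upto_diff depends_upto_add depends_upto_mult depends_upto_const dep 12 21 32
          depends_upto_rhs depends_upto_coord) (use m A B in \<open>auto simp: M_def\<close>)
    \<comment> \<open>\<open>D_x D_x D_x h\<close> does not exceed the order \<open>M\<close> of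
      \<open>D_x D_x h\<close>, so the latter loses its highest derivative; then
      \<open>D_x h\<close> loses its own for the same reason.\<close>
    then have "jet_smooth I (Suc m) (Dx (Dx h))"
      using jet_smooth_reduce_Dx[OF I h2] by (simp add: M_def)
    then have "jet_smooth I m (Dx h)"
      using jet_smooth_reduce_Dx[OF I h1] by (simp add: jet_smooth_iff)
    then show ?thesis
      by (simp add: jet_smooth_iff)
  qed
  then have h0: "jet_smooth I 0 h"
    using jet_smooth_reduce_Dx_upto[OF I hk] by blast
  \<comment> \<open>If \<open>h\<close> were constant, then \<open>f_{12} = - \<eta> h\<close> and
    \<open>f_{22} = - h f_{21}\<close>, and \<open>\<omega>1 \<and> \<omega>2\<close> would
    vanish.\<close>
  obtain u0 where u0: "u0 \<in> jets I" "pd 0 h u0 \<noteq> 0"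
  proof (rule ccontr)
    assume "\<not> thesis"
    then have pd0: "pd 0 h u = 0" if "u \<in> jets I" for u
      using that \<open>\<And>u. u \<in> jets I \<Longrightarrow> pd 0 h u \<noteq> 0 \<Longrightarrow> thesis\<close> by blast
    obtain u where u: "u \<in> jets I" "\<eta> * f 2 2 u - f 1 2 u * f 2 1 u \<noteq> 0"
      by (rule wedge_nonzero)
    have "Dx h u = 0" if "u \<in> jets I" for u
      using Dx_order_0[OF I h0 that] pd0[OF that] by simp
    then have "Dx h u = 0" "Dx (Dx h) u = 0"
      using Dx_cong[OF I u(1), of "Dx h" "\<lambda>_. 0"] u by (simp_all add: Dx_const)
    then show False
      using u(2) f12[OF u(1)] f22[OF u(1)] by simp
  qed
  have "continuous_on (jets I) (pd 0 h)"
    using jet_smooth_pd[OF I h0, of 0] by (simp add: jet_smooth_iff smooth_on_jets_continuous)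
  then have gen: "generically_nonzero I (pd 0 h)"
    using generically_nonzeroI[OF I] u0 by blast
  have m: "f 2 1 u = 1 / \<alpha> * (u 0 - lam * u 2 + \<epsilon> * \<eta>\<^sup>2 / 2 - \<epsilon> * \<alpha>\<^sup>2 / 2)" if u: "u \<in> jets I" for u
    unfolding f21[OF u] p\<alpha> \<rho> using \<alpha> by (simp add: field_simps)
  show ?thesis
    unfolding form_II_def Let_def
  proof (rule bexI[OF _ \<epsilon>], rule exI[of _ \<eta>], rule exI[of _ \<alpha>], rule exI[of _ h],
      intro conjI ballI)
    fix u assume u: "u \<in> jets I"
    show "f 2 2 u = 1 / \<alpha> * (- \<epsilon> * Dx (Dx h) u - \<eta> * Dx h u -
      (u 0 - lam * u 2 + \<epsilon> * \<eta>\<^sup>2 / 2 - \<epsilon> * \<alpha>\<^sup>2 / 2) * h u)"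
      unfolding f22[OF u] m[OF u] by (simp add: algebra_simps)
    show "f 3 1 u = \<epsilon> * f 2 1 u + \<alpha>"
      unfolding f31[OF u] f21[OF u] \<sigma> by (simp add: algebra_simps)
    show "A u * u 3 + B u =
      - \<epsilon> * Dx (Dx (Dx h)) u - Dx (\<lambda>u. (u 0 - lam * u 2) * h u) u - (u 0 - lam * u 2) * Dx h u"
    proof -
      define w w' m where "w = u 0 - lam * u 2" and "w' = u 1 - lam * u 3"
        and "m = w + \<epsilon> * (\<eta>\<^sup>2 - \<alpha>\<^sup>2) / 2"
      have g21: "f 2 1 u = m / \<alpha>" and g31: "f 3 1 u = \<epsilon> * (m / \<alpha>) + \<alpha>"
        unfolding f21[OF u] f31[OF u] p\<alpha> \<sigma> \<rho> m_def w_def using \<alpha> by (simp_all add: field_simps)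
      have g22: "f 2 2 u = (- \<epsilon> * Dx (Dx h) u - \<eta> * Dx h u - m * h u) / \<alpha>"
        unfolding f22[OF u] g21 using \<alpha> by (simp add: field_simps)
      have "Dx (f 2 2) u = Dx (\<lambda>u. 1 / \<alpha> * (- \<epsilon> * Dx (Dx h) u - \<eta> * Dx h u) -
          h u * (p * (u 0 - lam * u 2) + \<rho>)) u"
        by (rule Dx_cong[OF I u]) (use f22 f21 in auto)
      also have "\<dots> = 1 / \<alpha> * (- \<epsilon> * Dx (Dx (Dx h)) u - \<eta> * Dx (Dx h) u) -
          (Dx h u * f 2 1 u + h u * (p * w'))"
        unfolding f21[OF u] w'_def
        by (simp add: simps u)
      also have "\<dots> = (- \<epsilon> * Dx (Dx (Dx h)) u - \<eta> * Dx (Dx h) u - w' * h u - m * Dx h u) / \<alpha>"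
        unfolding g21 p\<alpha> using \<alpha> by (simp add: field_simps)
      finally have D22: "Dx (f 2 2) u = \<dots>" .
      have "A u * u 3 + B u = \<alpha> * (Dx (f 2 2) u - \<eta> * f 3 2 u + f 1 2 u * f 3 1 u)"
        unfolding structure_equations_explicit(2)[OF u] p\<alpha> using \<alpha> by simp
      also have "\<dots> = - \<epsilon> * Dx (Dx (Dx h)) u - w' * h u - 2 * w * Dx h u"
        unfolding D22 f32 f12[OF u] g22 g31 using \<alpha> \<epsilon>
        by (auto simp: m_def field_simps power2_eq_square)
      also have "\<dots> = - \<epsilon> * Dx (Dx (Dx h)) u - (w' * h u + w * Dx h u) - w * Dx h u"
        by simp
      also have "w' * h u + w * Dx h u = Dx (\<lambda>u. (u 0 - lam * u 2) * h u) u"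
        unfolding w_def w'_def by (simp add: simps u)
      finally show ?thesis
        by (simp add: w_def)
    qed
  qed (use h0 gen \<alpha> f11 f12 m f32 in auto)
qed

end

section \<open>Normalisation by linear coordinate transformations\<close>

lemma old_coord_w:
  "c \<noteq> 0 \<Longrightarrow> old_coord a c c0 0 (u 0) - lam * old_coord a c c0 2 (u 2) =
    (u 0 - tr_lam a lam * u 2 - c0) / c"
  by (simp add: old_coord_def tr_lam_def field_simps)

lemma normal_form_of_describes:
  assumes I: "jet_domain I" and A: "jet_smooth I 2 A" and B: "jet_smooth I 2 B"
    and \<delta>: "\<delta> \<in> {1, -1}"
    and D: "describes I \<delta> (third_order_eq lam A B) f" and adm: "admissible I \<delta> f"
  shows "\<delta> = 1 \<and> (\<exists>a b c c0. a * b * c \<noteq> 0 \<and>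
    (form_I (tr_domain a c c0 I) (tr_lam a lam) (tr_A a b c c0 A) (tr_B a b c c0 B)
       (tr_forms a b c c0 f) \<or>
     form_II (tr_domain a c c0 I) (tr_lam a lam) (tr_A a b c c0 A) (tr_B a b c c0 B)
       (tr_forms a b c c0 f)))"
proof -
  obtain \<epsilon> \<eta> p \<rho> \<sigma> where \<delta>1: "\<delta> = 1" and \<epsilon>: "\<epsilon> \<in> {1, -1}" and p: "p \<noteq> 0"
    and f11: "\<And>u. u \<in> jets I \<Longrightarrow> f 1 1 u = \<eta>"
    and f21: "\<And>u. u \<in> jets I \<Longrightarrow> f 2 1 u = p * (u 0 - lam * u 2) + \<rho>"
    and f31: "\<And>u. u \<in> jets I \<Longrightarrow> f 3 1 u = \<epsilon> * p * (u 0 - lam * u 2) + \<sigma>"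
    by (rule describes_affine_coefficients[OF I \<delta> D adm]) blast
  have D1: "describes I 1 (third_order_eq lam A B) f"
    using D \<delta>1 by simp
  have AB': "jet_smooth (tr_domain a c c0 I) 2 (tr_A a b c c0 A)"
    "jet_smooth (tr_domain a c c0 I) 2 (tr_B a b c c0 B)"
    if "a \<noteq> 0" "c \<noteq> 0" for a b c c0
    unfolding tr_A_def[abs_def] tr_B_def[abs_def]
    by (intro jet_smooth_mult jet_smooth_const jet_smooth_tr_fun jet_domain_tr_domain I A B that)+
  have tr: "tr_forms a b c c0 f 1 1 u = \<eta> / a"
    "tr_forms a b c c0 f 2 1 u = (p * ((u 0 - tr_lam a lam * u 2 - c0) / c) + \<rho>) / a"
    "tr_forms a b c c0 f 3 1 u = (\<epsilon> * p * ((u 0 - tr_lam a lam * u 2 - c0) / c) + \<sigma>) / a"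
    if "c \<noteq> 0" "u \<in> jets (tr_domain a c c0 I)" for a b c c0 u
    using that f11 f21 f31 by (simp_all add: tr_forms_def tr_fun_def jets_tr_domain old_coord_w)
  show ?thesis
  proof (cases "\<sigma> = \<epsilon> * \<rho>")
    case True
    obtain \<mu> where f12: "\<And>u. u \<in> jets I \<Longrightarrow> f 1 2 u = \<mu>"
      and f32: "\<And>u. u \<in> jets I \<Longrightarrow> f 3 2 u = \<epsilon> * f 2 2 u"
      by (rule constant_f12_if_proportional[OF I A B D1 \<epsilon> p f11 f21 f31 True]) blast+
    \<comment> \<open>Scaling \<open>x\<close> and \<open>t\<close> brings the constants
      \<open>f_{11} = \<eta>\<close> and \<open>f_{12} = \<mu>\<close> to
      \<open>- \<epsilon>\<close> and \<open>\<epsilon>\<close>. A zero constant stays zero under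
      any scaling, and the factor is then set to 1.\<close>
    define a where "a = (if \<eta> = 0 then 1 else - \<epsilon> * \<eta>)"
    define b where "b = (if \<mu> = 0 then 1 else \<epsilon> * \<mu>)"
    \<comment> \<open>As \<open>\<lambda>' = a^2 \<lambda>\<close>, the combination
      \<open>w = z - \<lambda> z_2\<close> transforms to \<open>w' = c w + c0\<close>. The values of
      \<open>c\<close> and \<open>c0\<close> solve \<open>(p w + \<rho>) / a = w'\<close>; because
      \<open>\<sigma> = \<epsilon> \<rho>\<close>, they normalise \<open>f_{31}\<close> at the same
      time.\<close>
    define c where "c = p / a"
    define c0 where "c0 = \<rho> / a"
    have abc: "a \<noteq> 0" "b \<noteq> 0" "c \<noteq> 0"
      using \<epsilon> p by (auto simp: a_def b_def c_def)
    have "form_I (tr_domain a c c0 I) (tr_lam a lam) (tr_A a b c c0 A) (tr_B a b c c0 B)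
       (tr_forms a b c c0 f)"
    proof (rule form_I_of_describes[where p = 1 and \<rho> = 0 and \<sigma> = 0 and
          \<eta> = "- \<epsilon> * (if \<eta> = 0 then 0 else 1)" and a = "if \<eta> = 0 then 0 else 1" and
          b = "if \<mu> = 0 then 0 else 1", OF jet_domain_tr_domain[OF I abc(1,3)] AB'[OF abc(1,3)]
          describes_tr[OF I abc D1] \<epsilon>])
      fix u assume u: "u \<in> jets (tr_domain a c c0 I)"
      show "tr_forms a b c c0 f 1 1 u = - \<epsilon> * (if \<eta> = 0 then 0 else 1)"
        using tr(1)[OF abc(3) u, of b] \<epsilon> by (auto simp: a_def)
      show "tr_forms a b c c0 f 2 1 u = 1 * (u 0 - tr_lam a lam * u 2) + 0"
        unfolding tr(2)[OF abc(3) u, of b] using abc p by (simp add: c_def c0_def field_simps)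
      show "tr_forms a b c c0 f 3 1 u = \<epsilon> * 1 * (u 0 - tr_lam a lam * u 2) + 0"
        unfolding tr(3)[OF abc(3) u, of b] True using abc p by (simp add: c_def c0_def field_simps)
      show "tr_forms a b c c0 f 1 2 u = \<epsilon> * (if \<mu> = 0 then 0 else 1)"
        using f12 u \<epsilon> by (auto simp: tr_forms_def tr_fun_def jets_tr_domain b_def)
      show "tr_forms a b c c0 f 3 2 u = \<epsilon> * tr_forms a b c c0 f 2 2 u"
        using f32 u by (simp add: tr_forms_def tr_fun_def jets_tr_domain)
    qed auto
    then show ?thesis
      using \<delta>1 abc by (intro conjI exI[of _ a] exI[of _ b] exI[of _ c] exI[of _ c0]) auto
  next
    case False
    \<comment> \<open>\<open>c\<close> and \<open>c0\<close> are determined by \<open>p w + \<rho> = (w' + \<kappa>) / \<alpha>\<close>, where \<open>w' = c w + c0\<close>.\<close>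
    define \<alpha> where "\<alpha> = \<sigma> - \<epsilon> * \<rho>"
    define \<kappa> where "\<kappa> = \<epsilon> * (\<eta>\<^sup>2 - \<alpha>\<^sup>2) / 2"
    define c where "c = p * \<alpha>"
    define c0 where "c0 = \<rho> * \<alpha> - \<kappa>"
    have \<alpha>: "\<alpha> \<noteq> 0"
      using False by (simp add: \<alpha>_def)
    \<comment> \<open>No scaling of \<open>x\<close> or \<open>t\<close> takes place:
      \<open>\<eta>\<close> and \<open>\<alpha>\<close> remain free parameters of form (II).\<close>
    have abc: "(1::real) \<noteq> 0" "(1::real) \<noteq> 0" "c \<noteq> 0"
      using p \<alpha> by (auto simp: c_def)
    have "form_II (tr_domain 1 c c0 I) (tr_lam 1 lam) (tr_A 1 1 c c0 A) (tr_B 1 1 c c0 B)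
       (tr_forms 1 1 c c0 f)"
    proof (rule form_II_of_describes[where p = "1 / \<alpha>" and \<eta> = \<eta> and \<rho> = "\<kappa> / \<alpha>" and
          \<sigma> = "\<epsilon> * (\<kappa> / \<alpha>) + \<alpha>" and \<alpha> = \<alpha>,
          OF jet_domain_tr_domain[OF I abc(1,3)] AB'[OF abc(1,3)] describes_tr[OF I abc D1] \<epsilon>])
      fix u assume u: "u \<in> jets (tr_domain 1 c c0 I)"
      show "tr_forms 1 1 c c0 f 1 1 u = \<eta>"
        using tr(1)[OF abc(3) u, of 1] by simp
      show "tr_forms 1 1 c c0 f 2 1 u = 1 / \<alpha> * (u 0 - tr_lam 1 lam * u 2) + \<kappa> / \<alpha>"
        unfolding tr(2)[OF abc(3) u, of 1] using p \<alpha> by (simp add: c_def c0_def field_simps)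
      have \<sigma>: "\<sigma> = \<epsilon> * \<rho> + \<alpha>"
        by (simp add: \<alpha>_def)
      show "tr_forms 1 1 c c0 f 3 1 u =
          \<epsilon> * (1 / \<alpha>) * (u 0 - tr_lam 1 lam * u 2) + (\<epsilon> * (\<kappa> / \<alpha>) + \<alpha>)"
        unfolding tr(3)[OF abc(3) u, of 1] \<sigma> using p \<alpha> by (simp add: c_def c0_def field_simps)
    qed (use \<alpha> in \<open>auto simp: \<kappa>_def\<close>)
    then show ?thesis
      using \<delta>1 abc by (intro conjI exI[of _ 1] exI[of _ c] exI[of _ c0]) auto
  qed
qed

lemma describes_of_normal_form:
  assumes I: "jet_domain I" and abc: "a * b * c \<noteq> 0"
    and form: "form_I (tr_domain a c c0 I) (tr_lam a lam) (tr_A a b c c0 A) (tr_B a b c c0 B) g \<or>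
      form_II (tr_domain a c c0 I) (tr_lam a lam) (tr_A a b c c0 A) (tr_B a b c c0 B) g"
  defines "f \<equiv> tr_forms (1 / a) (1 / b) (1 / c) (- (c0 / c)) g"
  shows "describes I 1 (third_order_eq lam A B) f \<and> admissible I 1 f"
proof -
  have abc: "a \<noteq> 0" "b \<noteq> 0" "c \<noteq> 0"
    using abc by auto
  note I' = jet_domain_tr_domain[OF I abc(1,3), of c0]
  from form have "describes (tr_domain a c c0 I) 1
      (third_order_eq (tr_lam a lam) (tr_A a b c c0 A) (tr_B a b c c0 B)) g \<and>
    admissible (tr_domain a c c0 I) 1 g"
    using form_I_describes[OF I'] form_II_describes[OF I'] by blast
  then show ?thesis
    unfolding f_def using describes_admissible_of_tr[OF I abc] by blast
qed

theorem theorem3p1: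
  fixes I :: "nat \<Rightarrow> real set" and lam :: real and A B :: jetfun
  assumes "jet_domain I"
    and "jet_smooth I 2 A" and "jet_smooth I 2 B"
    and "generically_nonzero I (\<lambda>u. (A u)\<^sup>2 + (B u)\<^sup>2)"
  shows
    "((\<exists>\<delta>\<in>{1, -1}. \<exists>f. describes I \<delta> (third_order_eq lam A B) f \<and> admissible I \<delta> f) \<longleftrightarrow>
       (\<exists>a b c c0 g. a * b * c \<noteq> 0 \<and>
          (form_I (tr_domain a c c0 I) (tr_lam a lam) (tr_A a b c c0 A) (tr_B a b c c0 B) g \<or>
           form_II (tr_domain a c c0 I) (tr_lam a lam) (tr_A a b c c0 A) (tr_B a b c c0 B) g))) \<and>
     (\<forall>\<delta>\<in>{1, -1}. \<forall>f.
       describes I \<delta> (third_order_eq lam A B) f \<and> admissible I \<delta> f \<longleftrightarrow>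
       \<delta> = 1 \<and>
       (\<exists>a b c c0. a * b * c \<noteq> 0 \<and>
          (form_I (tr_domain a c c0 I) (tr_lam a lam) (tr_A a b c c0 A) (tr_B a b c c0 B)
             (tr_forms a b c c0 f) \<or>
           form_II (tr_domain a c c0 I) (tr_lam a lam) (tr_A a b c c0 A) (tr_B a b c c0 B)
             (tr_forms a b c c0 f))))"
  (is "?equivalence \<and> ?forms")
proof
  have forward: "\<delta> = 1 \<and> (\<exists>a b c c0. a * b * c \<noteq> 0 \<and>
    (form_I (tr_domain a c c0 I) (tr_lam a lam) (tr_A a b c c0 A) (tr_B a b c c0 B)
       (tr_forms a b c c0 f) \<or>
     form_II (tr_domain a c c0 I) (tr_lam a lam) (tr_A a b c c0 A) (tr_B a b c c0 B)
       (tr_forms a b c c0 f)))"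
    if "\<delta> \<in> {1, -1}" "describes I \<delta> (third_order_eq lam A B) f \<and> admissible I \<delta> f" for \<delta> f
    using normal_form_of_describes[OF assms(1-3) that(1)] that(2) by blast
  note backward = describes_of_normal_form[OF assms(1)]
  show ?equivalence
  proof
    assume "\<exists>\<delta>\<in>{1, -1}. \<exists>f. describes I \<delta> (third_order_eq lam A B) f \<and> admissible I \<delta> f"
    then show "\<exists>a b c c0 g. a * b * c \<noteq> 0 \<and>
          (form_I (tr_domain a c c0 I) (tr_lam a lam) (tr_A a b c c0 A) (tr_B a b c c0 B) g \<or>
           form_II (tr_domain a c c0 I) (tr_lam a lam) (tr_A a b c c0 A) (tr_B a b c c0 B) g)"
      using forward by meson
  next
    assume "\<exists>a b c c0 g. a * b * c \<noteq> 0 \<and>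
          (form_I (tr_domain a c c0 I) (tr_lam a lam) (tr_A a b c c0 A) (tr_B a b c c0 B) g \<or>
           form_II (tr_domain a c c0 I) (tr_lam a lam) (tr_A a b c c0 A) (tr_B a b c c0 B) g)"
    then show "\<exists>\<delta>\<in>{1, -1}. \<exists>f. describes I \<delta> (third_order_eq lam A B) f \<and> admissible I \<delta> f"
      using backward by blast
  qed
  show ?forms
  proof (intro ballI allI iffI)
    fix \<delta> :: real and f
    assume "\<delta> = 1 \<and> (\<exists>a b c c0. a * b * c \<noteq> 0 \<and>
      (form_I (tr_domain a c c0 I) (tr_lam a lam) (tr_A a b c c0 A) (tr_B a b c c0 B)
         (tr_forms a b c c0 f) \<or>
       form_II (tr_domain a c c0 I) (tr_lam a lam) (tr_A a b c c0 A) (tr_B a b c c0 B)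
         (tr_forms a b c c0 f)))"
    then obtain a b c c0 where \<delta>: "\<delta> = 1" and abc: "a * b * c \<noteq> 0" and
      "form_I (tr_domain a c c0 I) (tr_lam a lam) (tr_A a b c c0 A) (tr_B a b c c0 B)
         (tr_forms a b c c0 f) \<or>
       form_II (tr_domain a c c0 I) (tr_lam a lam) (tr_A a b c c0 A) (tr_B a b c c0 B)
         (tr_forms a b c c0 f)"
      by blast
    \<comment> \<open>Here the forms in the new coordinates are the transforms of the given
      \<open>f\<close>, so the forms that \<open>backward\<close> provides by the inverse
      transformation are \<open>f\<close> itself.\<close>
    from backward[OF this(2,3)] abc
    show "describes I \<delta> (third_order_eq lam A B) f \<and> admissible I \<delta> f"
      by (simp add: \<delta> tr_inverse)
  qed (rule forward)
qed

end
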